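(* Let $P,Q\in\mathbb Z$ with $Q\ne0$, $f(t)=t^2-Pt+Q$ with roots $\theta_1,\theta_2$, $D=P^2-4Q\neq0$, and let $p$ be a prime with $p\nmid Q$; write $D=p^sD_0$ with $s\ge0$, $p\nmid D_0$. For $R\in\{\mathbb Q,\mathbb Z_{(p)},\mathbb F_p\}$ let $G^*_R(f)$ be as in the context. (1) If $f$ is irreducible over $\mathbb Q$, then $G^*_{\mathbb Q}(f)\xrightarrow{\sim}\mathbb Q(\theta_1)^{\times}/\mathbb Q^{\times}\langle\theta_1\rangle$, $[w_1:w_0]\mapsto w_1-w_0\theta_1$. If $f$ is reducible over $\mathbb Q$, then $G^*_{\mathbb Q}(f)\xrightarrow{\sim}\mathbb Q^{\times}/\langle\theta_1\theta_2^{-1}\rangle$, $[w_1:w_0]\mapsto(w_1-w_0\theta_1)(w_1-w_0\theta_2)^{-1}$. (2) If $f$ is irreducible over $\mathbb Q$, then $G^*_{\mathbb Z_{(p)}}(f)\xrightarrow{\sim}\mathbb Z_{(p)}[\theta_1]^{\times}/\mathbb Z_{(p)}^{\times}\langle\theta_1\rangle$, $[w_1:w_0]\mapsto w_1-w_0\theta_1$. If $f$ is reducible over $\mathbb Q$, then $G^*_{\mathbb Z_{(p)}}(f)$ is isomorphic to $\mathbb Z_{(p)}^{\times}/\langle\theta_1\theta_2^{-1}\rangle$ if $p\nmid D$ and to $(1+p^{s/2}\mathbb Z_{(p)})/\langle\theta_1\theta_2^{-1}\rangle$ if $p\mid D$, via $[w_1:w_0]\mapsto(w_1-w_0\theta_1)(w_1-w_0\theta_2)^{-1}$.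 (3)(i) If $f\bmod p$ is irreducible over $\mathbb F_p$, then $G^*_{\mathbb F_p}(f)\xrightarrow{\sim}\mathbb F_p(\theta_1)^{\times}/\mathbb F_p^{\times}\langle\theta_1\rangle$, $[w_1:w_0]\mapsto w_1-w_0\theta_1$. (ii) If $f\bmod p$ is reducible over $\mathbb F_p$: if $p\nmid D$, then $G^*_{\mathbb F_p}(f)\xrightarrow{\sim}\mathbb F_p^{\times}/\langle\theta_1\theta_2^{-1}\rangle$, $[w_1:w_0]\mapsto(w_1-w_0\theta_1)(w_1-w_0\theta_2)^{-1}$; if $p\mid D$, then $G^*_{\mathbb F_p}(f)$ is trivial.
   Context: For an integral domain $R$ in which $Q$ is a unit, let $\mathscr S(f,R)^{\times}$ be the set of sequences $(w_n)_{n\in\mathbb Z}$ in $R$ with $w_{n+2}-Pw_{n+1}+Qw_n=0$ and $w_1^2-Pw_0w_1+Qw_0^2\in R^{\times}$; it is an abelian group with product $(w_n)*(v_n)=(u_n)$, $u_1=w_1v_1-Qw_0v_0$, $u_0=w_0v_1+w_1v_0-Pw_0v_0$. Define ${\bf w}\sim^*{\bf v}$ if there are $\lambda\in R^{\times}$ and $\nu\in\mathbb Z$ with $w_n=\lambda v_{n+\nu}$ for all $n$; $G^*_R(f):=\mathscr S(f,R)^{\times}/\sim^*$ with the induced group structure, and $[w_1:w_0]$ is the class of the sequence with initial terms $w_1,w_0$. For $R=\mathbb F_p$, everything is reduced mod $p$. ($G^*_{\mathbb Q}(f)$ is naturally identified with Laxton's group $G^*(f)$.) *)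

theory Defs
  imports
    "HOL-Algebra.Algebra"
    "HOL-Algebra.Algebraic_Closure_Type"
    "HOL-Number_Theory.Residues"
begin

section \<open>The group of second-order linear recurrences over a ring\<close>

context
  fixes R :: "('a, 'b) ring_scheme" (structure) and P Q :: 'a
begin

definition lrec_seqs :: "(int \<Rightarrow> 'a) set" where
  "lrec_seqs = {w. (\<forall>n. w n \<in> carrier R) \<and>
                   (\<forall>n. w (n + 2) \<ominus> P \<otimes> w (n + 1) \<oplus> Q \<otimes> w n = \<zero>)}"

definition lrec_norm :: "'a \<Rightarrow> 'a \<Rightarrow> 'a" where
  "lrec_norm w1 w0 = w1 [^] (2::nat) \<ominus> P \<otimes> w0 \<otimes> w1 \<oplus> Q \<otimes> w0 [^] (2::nat)"

definition lrec_units :: "(int \<Rightarrow> 'a) set" where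
  "lrec_units = {w \<in> lrec_seqs. lrec_norm (w 1) (w 0) \<in> Units R}"

text \<open>The arguments are in the order of the bracket notation $[w_1:w_0]$. The sequence is
  determined by its two initial terms, in both directions, as soon as \<open>Q\<close> is a unit.\<close>

definition lrec_of_init :: "'a \<Rightarrow> 'a \<Rightarrow> int \<Rightarrow> 'a" where
  "lrec_of_init w1 w0 = (THE w. w \<in> lrec_seqs \<and> w 1 = w1 \<and> w 0 = w0)"

definition lrec_mult :: "(int \<Rightarrow> 'a) \<Rightarrow> (int \<Rightarrow> 'a) \<Rightarrow> int \<Rightarrow> 'a" where
  "lrec_mult w v =
     lrec_of_init (w 1 \<otimes> v 1 \<ominus> Q \<otimes> w 0 \<otimes> v 0)
                  (w 0 \<otimes> v 1 \<oplus> w 1 \<otimes> v 0 \<ominus> P \<otimes> w 0 \<otimes> v 0)"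

definition lrec_equiv :: "((int \<Rightarrow> 'a) \<times> (int \<Rightarrow> 'a)) set" where
  "lrec_equiv = {(w, v). w \<in> lrec_units \<and> v \<in> lrec_units \<and>
                         (\<exists>c \<in> Units R. \<exists>\<nu>::int. \<forall>n. w n = c \<otimes> v (n + \<nu>))}"

definition lrec_class :: "'a \<Rightarrow> 'a \<Rightarrow> (int \<Rightarrow> 'a) set" where
  "lrec_class w1 w0 = lrec_equiv `` {lrec_of_init w1 w0}"

definition Gstar :: "(int \<Rightarrow> 'a) set monoid" where
  "Gstar = \<lparr>carrier = lrec_units // lrec_equiv,
            monoid.mult = \<lambda>A B. lrec_equiv `` {lrec_mult w v | w v. w \<in> A \<and> v \<in> B},
            one = lrec_class \<one> \<zero>\<rparr>"

text \<open>There is a group isomorphism from \<open>Gstar\<close> onto \<open>M / N\<close> that sends every class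
  $[w_1:w_0]$ to the coset of \<open>g w\<^sub>1 w\<^sub>0\<close>. The first two
  conjuncts are needed because \<^const>\<open>iso\<close> and \<^const>\<open>FactGroup\<close> do not themselves
  require groups and normal subgroups.\<close>

definition Gstar_iso_via :: "'c monoid \<Rightarrow> 'c set \<Rightarrow> ('a \<Rightarrow> 'a \<Rightarrow> 'c) \<Rightarrow> bool" where
  "Gstar_iso_via M N g \<longleftrightarrow>
     group Gstar \<and> N \<lhd> M \<and>
     (\<exists>\<phi> \<in> iso Gstar (M Mod N).
        \<forall>w1 \<in> carrier R. \<forall>w0 \<in> carrier R.
          lrec_norm w1 w0 \<in> Units R \<longrightarrow> \<phi> (lrec_class w1 w0) = N #>\<^bsub>M\<^esub> g w1 w0)"

text \<open>The polynomial $t^2 - Pt + Q$; coefficient lists start with the leading coefficient.\<close>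

definition char_poly2 :: "'a list" where
  "char_poly2 = [\<one>, \<ominus> P, Q]"

end

text \<open>$t^2 - Pt + Q = (t - \theta_1)(t - \theta_2)$ as polynomials over \<open>L\<close>.\<close>

definition has_roots2 :: "('a, 'b) ring_scheme \<Rightarrow> 'a \<Rightarrow> 'a \<Rightarrow> 'a \<Rightarrow> 'a \<Rightarrow> bool" where
  "has_roots2 L P Q \<theta>1 \<theta>2 \<longleftrightarrow>
     \<theta>1 \<in> carrier L \<and> \<theta>2 \<in> carrier L \<and>
     char_poly2 L P Q = [\<one>\<^bsub>L\<^esub>, \<ominus>\<^bsub>L\<^esub> \<theta>1] \<otimes>\<^bsub>poly_ring L\<^esub> [\<one>\<^bsub>L\<^esub>, \<ominus>\<^bsub>L\<^esub> \<theta>2]"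

definition irreducible2 :: "('a, 'b) ring_scheme \<Rightarrow> 'a \<Rightarrow> 'a \<Rightarrow> bool" where
  "irreducible2 K P Q \<longleftrightarrow> ring_irreducible\<^bsub>poly_ring K\<^esub> (char_poly2 K P Q)"


section \<open>The coefficient rings\<close>

abbreviation rat_field :: "rat ring" where
  "rat_field \<equiv> ring_of_type_algebra"

abbreviation complex_field :: "complex ring" where
  "complex_field \<equiv> ring_of_type_algebra"

definition int_localized :: "nat \<Rightarrow> rat set" where
  "int_localized p = {of_int a / of_int b | a b :: int. \<not> int p dvd b}"

abbreviation int_localized_ring :: "nat \<Rightarrow> rat ring" where
  "int_localized_ring p \<equiv> rat_field\<lparr>carrier := int_localized p\<rparr>"

abbreviation prime_field :: "nat \<Rightarrow> int ring" where
  "prime_field p \<equiv> residue_ring (int p)"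

abbreviation units_in :: "('a, 'b) ring_scheme \<Rightarrow> 'a set \<Rightarrow> 'a monoid" where
  "units_in L S \<equiv> units_of (L\<lparr>carrier := S\<rparr>)"

text \<open>The subset $U\langle\theta\rangle$ of a group \<open>M\<close>.\<close>

definition times_cyclic :: "'a monoid \<Rightarrow> 'a set \<Rightarrow> 'a \<Rightarrow> 'a set" where
  "times_cyclic M U \<theta> = U <#>\<^bsub>M\<^esub> generate M {\<theta>}"

end

theory Submission
  imports Defs
begin

text \<open>Identify a sequence with the element \<open>w\<^sub>1 - w\<^sub>0 \<theta>\<^sub>1\<close> of \<open>R[t]/(t\<^sup>2 - Pt + Q)\<close>. The group law on
  sequences becomes multiplication, the expression \<open>w\<^sub>1\<^sup>2 - P w\<^sub>0 w\<^sub>1 + Q w\<^sub>0\<^sup>2\<close> becomes the norm, and the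
  index shift becomes multiplication by \<open>\<theta>\<^sub>2 = P - \<theta>\<^sub>1\<close>. Hence \<open>Gstar\<close> is the quotient of the unit group by
  \<open>R\<^sup>\<times>\<langle>\<theta>\<^sub>2\<rangle> = R\<^sup>\<times>\<langle>\<theta>\<^sub>1\<rangle>\<close>. If \<open>1\<close> and \<open>\<theta>\<^sub>1\<close> are independent over \<open>R\<close>, that quotient can be read off in
  \<open>R[\<theta>\<^sub>1]\<close>. If the roots are distinct elements of \<open>R\<close>, the quotient of the two evaluations has kernel \<open>R\<^sup>\<times>\<close>,
  and its image is all of \<open>R\<^sup>\<times>\<close> when \<open>\<theta>\<^sub>1 - \<theta>\<^sub>2\<close> is a unit; in general it consists of units congruent to \<open>1\<close>
  modulo \<open>\<theta>\<^sub>1 - \<theta>\<^sub>2\<close>. A double root in the field with \<open>p\<close> elements gives units modulo scalars that form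
  a group of order \<open>p\<close>, generated by the shift.\<close>

text \<open>The two cyclic subgroups agree modulo scalars because
  \<open>\<theta>1 \<theta>2 = Q\<close> is a unit. The roots need not lie in the coefficient ring,
  and the algebra may be split or, modulo \<open>p\<close>, contain nilpotents, so evaluation at one
  root does not always detect its units. The group is therefore built on pairs of coefficients, with
  the norm as the test for invertibility; an embedding \<open>h\<close> into a field
  \<open>L\<close> containing the roots enters only afterwards. The exponent \<open>s / 2\<close>
  comes from \<open>a - b \<theta>1 = (a - b \<theta>2) - b (\<theta>1 - \<theta>2)\<close>: the
  quotient of the evaluations is \<open>1 - b (\<theta>1 - \<theta>2) / (a - b \<theta>2)\<close>,
  and the square of \<open>\<theta>1 - \<theta>2\<close> is \<open>D\<close>. Rational roots are
  integers, so in that case \<open>D\<close> is a square of an integer, \<open>s\<close> is even,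
  and \<open>\<theta>1 - \<theta>2\<close> is \<open>p^(s/2)\<close> times a unit of the local ring.
  The local ring is not a field; what it needs from irreducibility is imported from the
  rationals.\<close>

section \<open>The quadratic algebra: norm, conjugation and units\<close>

locale lrec = cring R for R :: "('a, 'b) ring_scheme" (structure) +
  fixes P Q :: 'a
  assumes P_closed [simp, intro]: "P \<in> carrier R"
    and Q_unit: "Q \<in> Units R"
begin

lemma Q_closed [simp, intro]: "Q \<in> carrier R"
  using Q_unit by (rule Units_closed)

text \<open>The pair \<open>(a, b)\<close> stands for \<open>a - b \<theta>\<close>, where \<open>\<theta>\<close> is the class of the indeterminate in
  \<open>R[t]/(t\<^sup>2 - Pt + Q)\<close>.\<close>

definition quad :: "('a \<times> 'a) monoid" where
  "quad = \<lparr>carrier = carrier R \<times> carrier R,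
     monoid.mult = (\<lambda>(a, b) (c, d). (a \<otimes> c \<ominus> Q \<otimes> b \<otimes> d, b \<otimes> c \<oplus> a \<otimes> d \<ominus> P \<otimes> b \<otimes> d)),
     one = (\<one>, \<zero>)\<rparr>"

abbreviation nrm :: "'a \<Rightarrow> 'a \<Rightarrow> 'a" where
  "nrm \<equiv> lrec_norm R P Q"

lemma nrm_eq_mult:
  assumes "a \<in> carrier R" "b \<in> carrier R"
  shows "nrm a b = a \<otimes> a \<ominus> P \<otimes> b \<otimes> a \<oplus> Q \<otimes> (b \<otimes> b)"
  using assms by (simp add: lrec_norm_def numeral_2_eq_2)

text \<open>The product is that of \<open>a - b \<theta>\<close> and \<open>c - d \<theta>\<close>,
  reduced by \<open>\<theta>^2 = P \<theta> - Q\<close>.\<close>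

lemma carrier_quad [simp]: "carrier quad = carrier R \<times> carrier R"
  and mult_quad [simp]: "(a, b) \<otimes>\<^bsub>quad\<^esub> (c, d) =
    (a \<otimes> c \<ominus> Q \<otimes> b \<otimes> d, b \<otimes> c \<oplus> a \<otimes> d \<ominus> P \<otimes> b \<otimes> d)"
  and one_quad [simp]: "\<one>\<^bsub>quad\<^esub> = (\<one>, \<zero>)"
  by (simp_all add: quad_def)

lemma comm_monoid_quad: "comm_monoid quad"
proof (rule comm_monoidI)
  fix x y z assume "x \<in> carrier quad" "y \<in> carrier quad" "z \<in> carrier quad"
  then obtain a b c d e f where x: "x = (a, b)" "y = (c, d)" "z = (e, f)"
    and [simp]: "a \<in> carrier R" "b \<in> carrier R" "c \<in> carrier R" "d \<in> carrier R"
      "e \<in> carrier R" "f \<in> carrier R"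
    by auto
  note cl = this(4-9) P_closed Q_closed
  show "x \<otimes>\<^bsub>quad\<^esub> y \<otimes>\<^bsub>quad\<^esub> z = x \<otimes>\<^bsub>quad\<^esub> (y \<otimes>\<^bsub>quad\<^esub> z)"
  proof -
    have "(a \<otimes> c \<ominus> Q \<otimes> b \<otimes> d) \<otimes> e \<ominus> Q \<otimes> (b \<otimes> c \<oplus> a \<otimes> d \<ominus> P \<otimes> b \<otimes> d) \<otimes> f =
      a \<otimes> (c \<otimes> e \<ominus> Q \<otimes> d \<otimes> f) \<ominus> Q \<otimes> b \<otimes> (d \<otimes> e \<oplus> c \<otimes> f \<ominus> P \<otimes> d \<otimes> f)"
      using cl by algebra
    moreover have "(b \<otimes> c \<oplus> a \<otimes> d \<ominus> P \<otimes> b \<otimes> d) \<otimes> e \<oplus> (a \<otimes> c \<ominus> Q \<otimes> b \<otimes> d) \<otimes> f \<ominus>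
        P \<otimes> (b \<otimes> c \<oplus> a \<otimes> d \<ominus> P \<otimes> b \<otimes> d) \<otimes> f =
      b \<otimes> (c \<otimes> e \<ominus> Q \<otimes> d \<otimes> f) \<oplus> a \<otimes> (d \<otimes> e \<oplus> c \<otimes> f \<ominus> P \<otimes> d \<otimes> f) \<ominus>
        P \<otimes> b \<otimes> (d \<otimes> e \<oplus> c \<otimes> f \<ominus> P \<otimes> d \<otimes> f)"
      using cl by algebra
    ultimately show ?thesis by (simp add: x)
  qed
  show "x \<otimes>\<^bsub>quad\<^esub> y = y \<otimes>\<^bsub>quad\<^esub> x"
  proof -
    have "a \<otimes> c \<ominus> Q \<otimes> b \<otimes> d = c \<otimes> a \<ominus> Q \<otimes> d \<otimes> b"
      "b \<otimes> c \<oplus> a \<otimes> d \<ominus> P \<otimes> b \<otimes> d = d \<otimes> a \<oplus> c \<otimes> b \<ominus> P \<otimes> d \<otimes> b"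
      using cl by (algebra, algebra)
    then show ?thesis by (simp add: x)
  qed
qed (auto simp: minus_eq)

sublocale quad: comm_monoid quad
  by (rule comm_monoid_quad)

lemma nrm_closed [simp, intro]: "a \<in> carrier R \<Longrightarrow> b \<in> carrier R \<Longrightarrow> nrm a b \<in> carrier R"
  by (simp add: lrec_norm_def)

text \<open>The automorphism exchanging the roots: replacing \<theta> by \<open>P - \<theta>\<close>
  in \<open>a - b \<theta>\<close> gives \<open>(a - P b) + b \<theta>\<close>.\<close>

definition quad_conj :: "'a \<times> 'a \<Rightarrow> 'a \<times> 'a" where
  "quad_conj x = (fst x \<ominus> P \<otimes> snd x, \<ominus> snd x)"

lemma quad_conj_closed: "x \<in> carrier quad \<Longrightarrow> quad_conj x \<in> carrier quad"
  by (auto simp: quad_conj_def)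

lemma quad_conj_mult:
  assumes "x \<in> carrier quad" "y \<in> carrier quad"
  shows "quad_conj (x \<otimes>\<^bsub>quad\<^esub> y) = quad_conj x \<otimes>\<^bsub>quad\<^esub> quad_conj y"
proof -
  obtain a b c d where x: "x = (a, b)" "y = (c, d)" by (cases x, cases y)
  with assms have cl: "a \<in> carrier R" "b \<in> carrier R" "c \<in> carrier R" "d \<in> carrier R" by auto
  have "(a \<otimes> c \<ominus> Q \<otimes> b \<otimes> d) \<ominus> P \<otimes> (b \<otimes> c \<oplus> a \<otimes> d \<ominus> P \<otimes> b \<otimes> d) =
      (a \<ominus> P \<otimes> b) \<otimes> (c \<ominus> P \<otimes> d) \<ominus> Q \<otimes> (\<ominus> b) \<otimes> (\<ominus> d)"
    using cl P_closed Q_closed by algebra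
  moreover have "\<ominus> (b \<otimes> c \<oplus> a \<otimes> d \<ominus> P \<otimes> b \<otimes> d) =
      (\<ominus> b) \<otimes> (c \<ominus> P \<otimes> d) \<oplus> (a \<ominus> P \<otimes> b) \<otimes> (\<ominus> d) \<ominus> P \<otimes> (\<ominus> b) \<otimes> (\<ominus> d)"
    using cl P_closed Q_closed by algebra
  ultimately show ?thesis by (simp only: x quad_conj_def mult_quad fst_conv snd_conv)
qed

lemma mult_quad_conj:
  assumes "a \<in> carrier R" "b \<in> carrier R"
  shows "(a, b) \<otimes>\<^bsub>quad\<^esub> quad_conj (a, b) = (nrm a b, \<zero>)"
proof -
  have "a \<otimes> (a \<ominus> P \<otimes> b) \<ominus> Q \<otimes> b \<otimes> (\<ominus> b) = a \<otimes> a \<ominus> P \<otimes> b \<otimes> a \<oplus> Q \<otimes> (b \<otimes> b)"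
    using assms P_closed Q_closed by algebra
  moreover have "b \<otimes> (a \<ominus> P \<otimes> b) \<oplus> a \<otimes> (\<ominus> b) \<ominus> P \<otimes> b \<otimes> (\<ominus> b) = \<zero>"
    using assms P_closed Q_closed by algebra
  ultimately show ?thesis by (simp only: quad_conj_def mult_quad fst_conv snd_conv nrm_eq_mult[OF assms])
qed

text \<open>The norm is the product of an element with its conjugate, so multiplicativity is a
  regrouping of four factors in a commutative monoid. This avoids expanding the norm of a
  product.\<close>

lemma nrm_mult:
  assumes "a \<in> carrier R" "b \<in> carrier R" "c \<in> carrier R" "d \<in> carrier R"
  shows "nrm (a \<otimes> c \<ominus> Q \<otimes> b \<otimes> d) (b \<otimes> c \<oplus> a \<otimes> d \<ominus> P \<otimes> b \<otimes> d) = nrm a b \<otimes> nrm c d"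
proof -
  let ?x = "(a, b)" and ?y = "(c, d)"
  have cl: "?x \<in> carrier quad" "?y \<in> carrier quad" using assms by simp_all
  have "(nrm (a \<otimes> c \<ominus> Q \<otimes> b \<otimes> d) (b \<otimes> c \<oplus> a \<otimes> d \<ominus> P \<otimes> b \<otimes> d), \<zero>) =
      (?x \<otimes>\<^bsub>quad\<^esub> ?y) \<otimes>\<^bsub>quad\<^esub> quad_conj (?x \<otimes>\<^bsub>quad\<^esub> ?y)"
    unfolding mult_quad using assms by (subst mult_quad_conj) simp_all
  also have "\<dots> = (?x \<otimes>\<^bsub>quad\<^esub> quad_conj ?x) \<otimes>\<^bsub>quad\<^esub> (?y \<otimes>\<^bsub>quad\<^esub> quad_conj ?y)"
    using cl quad_conj_closed by (simp only: quad_conj_mult quad.m_ac quad.m_closed)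
  also have "\<dots> = (nrm a b \<otimes> nrm c d, \<zero>)"
    unfolding mult_quad_conj[OF assms(1,2)] mult_quad_conj[OF assms(3,4)] using assms by (simp add: minus_eq)
  finally show ?thesis by simp
qed

text \<open>This turns the condition in \<open>lrec_units\<close> into invertibility.
  Multiplicativity of the norm gives one direction; for the other, the inverse is the conjugate
  divided by the norm.\<close>

lemma Units_quad: "Units quad = {(a, b). a \<in> carrier R \<and> b \<in> carrier R \<and> nrm a b \<in> Units R}"
proof (intro equalityI subsetI)
  fix x assume "x \<in> Units quad"
  then obtain a b c d where x: "x = (a, b)" and cl: "a \<in> carrier R" "b \<in> carrier R" "c \<in> carrier R" "d \<in> carrier R"
    and "(a, b) \<otimes>\<^bsub>quad\<^esub> (c, d) = (\<one>, \<zero>)"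
    unfolding Units_def by auto
  then have "nrm a b \<otimes> nrm c d = nrm \<one> \<zero>"
    using nrm_mult[OF cl] by (simp del: r_right_minus_eq)
  also have "\<dots> = \<one>"
    using P_closed Q_closed by (simp add: nrm_eq_mult minus_eq l_minus r_minus r_neg)
  finally have "nrm a b \<in> Units R"
    using cl by (metis nrm_closed unit_factor Units_one_closed)
  with x cl show "x \<in> {(a, b). a \<in> carrier R \<and> b \<in> carrier R \<and> nrm a b \<in> Units R}" by simp
next
  fix x assume "x \<in> {(a, b). a \<in> carrier R \<and> b \<in> carrier R \<and> nrm a b \<in> Units R}"
  then obtain a b where x: "x = (a, b)" and cl: "a \<in> carrier R" "b \<in> carrier R"
    and u: "nrm a b \<in> Units R" by auto
  define i where "i = inv (nrm a b)"
  have i: "i \<in> carrier R" "i \<otimes> nrm a b = \<one>"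
    using u by (auto simp: i_def)
  have "x \<otimes>\<^bsub>quad\<^esub> (quad_conj x \<otimes>\<^bsub>quad\<^esub> (i, \<zero>)) = \<one>\<^bsub>quad\<^esub>"
    using quad.m_assoc[of x "quad_conj x" "(i, \<zero>)"] mult_quad_conj[OF cl] quad_conj_closed[of x] cl i
    by (simp add: x minus_eq m_comm[of "nrm a b"])
  moreover have "x \<in> carrier quad" "quad_conj x \<otimes>\<^bsub>quad\<^esub> (i, \<zero>) \<in> carrier quad"
    using cl i(1) x quad.m_closed[OF quad_conj_closed, of x "(i, \<zero>)"] by simp_all
  ultimately show "x \<in> Units quad"
    by (metis quad.Units_one_closed quad.unit_factor)
qed

abbreviation U where "U \<equiv> units_of quad"

sublocale U: comm_group U
  by (rule quad.units_comm_group)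

text \<open>The element \<open>P - \<theta>\<close>, that is, the other root; multiplication by it is the index shift.\<close>

definition t :: "'a \<times> 'a" where "t = (P, \<one>)"

lemma t_unit: "t \<in> Units quad"
proof -
  have "nrm P \<one> = Q"
    using P_closed Q_closed by (simp add: nrm_eq_mult minus_eq l_minus r_minus r_neg)
  then show ?thesis using Q_unit by (simp add: t_def Units_quad)
qed

lemma t_carrier [simp]: "t \<in> carrier U"
  using t_unit by (simp add: units_of_def)

text \<open>For \<open>(a, b) = (w (n + 1), w n)\<close> the result is
  \<open>(w (n + 2), w (n + 1))\<close>: this is one step of the recurrence.\<close>

lemma mult_t: "a \<in> carrier R \<Longrightarrow> b \<in> carrier R \<Longrightarrow> (a, b) \<otimes>\<^bsub>quad\<^esub> t = (P \<otimes> a \<ominus> Q \<otimes> b, a)"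
proof -
  assume cl: "a \<in> carrier R" "b \<in> carrier R"
  have "a \<otimes> P \<ominus> Q \<otimes> b \<otimes> \<one> = P \<otimes> a \<ominus> Q \<otimes> b" "b \<otimes> P \<oplus> a \<otimes> \<one> \<ominus> P \<otimes> b \<otimes> \<one> = a"
    using cl P_closed Q_closed by (algebra, algebra)
  then show ?thesis by (simp add: t_def)
qed

text \<open>Powers are taken in the unit group, so negative exponents are available and the
  recurrence also runs backwards.\<close>

abbreviation tpow :: "int \<Rightarrow> 'a \<times> 'a" where "tpow n \<equiv> t [^]\<^bsub>U\<^esub> n"

lemma tpow_unit: "tpow n \<in> Units quad"
  using U.int_pow_closed[OF t_carrier] by (simp add: units_of_def)

lemma tpow_closed [simp]: "tpow n \<in> carrier R \<times> carrier R"
  using quad.Units_closed[OF tpow_unit] by simp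

lemma tpow_add: "tpow (m + n) = tpow m \<otimes>\<^bsub>quad\<^esub> tpow n"
  using U.int_pow_mult[OF t_carrier] by (simp add: units_of_def)

lemma tpow_1: "tpow 1 = t"
  using U.int_pow_1[OF t_carrier] by simp

lemma tpow_0: "tpow 0 = (\<one>, \<zero>)"
  by (simp add: units_of_def)

section \<open>Sequences as orbits of the shift\<close>

lemma lrec_seqs_pair:
  assumes "w \<in> lrec_seqs R P Q"
  shows "(w (n + 1), w n) = (w 1, w 0) \<otimes>\<^bsub>quad\<^esub> tpow n"
proof -
  have cl: "w n \<in> carrier R" for n
    using assms by (simp add: lrec_seqs_def)
  have step: "(w (n + 1), w n) \<otimes>\<^bsub>quad\<^esub> t = (w (n + 2), w (n + 1))" for n
  proof -
    have "w (n + 2) \<ominus> P \<otimes> w (n + 1) \<oplus> Q \<otimes> w n = \<zero>"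
      using assms by (simp add: lrec_seqs_def)
    moreover have "P \<otimes> b \<ominus> Q \<otimes> c = a" if "a \<ominus> P \<otimes> b \<oplus> Q \<otimes> c = \<zero>"
      "a \<in> carrier R" "b \<in> carrier R" "c \<in> carrier R" for a b c
    proof -
      have "a = (a \<ominus> P \<otimes> b \<oplus> Q \<otimes> c) \<oplus> (P \<otimes> b \<ominus> Q \<otimes> c)"
        using that(2-) P_closed Q_closed by algebra
      then show ?thesis using that by simp
    qed
    ultimately have "P \<otimes> w (n + 1) \<ominus> Q \<otimes> w n = w (n + 2)"
      using cl by blast
    then show ?thesis by (simp add: mult_t cl)
  qed
  show ?thesis
  proof (induction n rule: int_induct[where k = 0])
    case base
    show ?case using quad.r_one[of "(w 1, w 0)"] cl by (simp add: tpow_0 del: int_pow_0)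
  next
    case (step1 i)
    have "(w (i + 1 + 1), w (i + 1)) = ((w 1, w 0) \<otimes>\<^bsub>quad\<^esub> tpow i) \<otimes>\<^bsub>quad\<^esub> t"
      using step[of i] step1(2) by (simp add: add.assoc)
    also have "\<dots> = (w 1, w 0) \<otimes>\<^bsub>quad\<^esub> tpow (i + 1)"
      using quad.m_assoc[of "(w 1, w 0)" "tpow i" t] cl quad.Units_closed[OF t_unit]
      by (simp add: tpow_add tpow_1)
    finally show ?case .
  next
    case (step2 i)
    \<comment> \<open>The downward step multiplies both sides by the unit \<open>t\<close>, where
      they agree by \<open>step\<close>, and then cancels \<open>t\<close>.\<close>
    have "tpow (i - 1) \<otimes>\<^bsub>quad\<^esub> t = tpow i"
      using tpow_add[of "i - 1" 1] by (simp add: tpow_1)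
    then have "((w 1, w 0) \<otimes>\<^bsub>quad\<^esub> tpow (i - 1)) \<otimes>\<^bsub>quad\<^esub> t = (w (i - 1 + 1), w (i - 1)) \<otimes>\<^bsub>quad\<^esub> t"
      using step[of "i - 1"] step2(2) quad.m_assoc[of "(w 1, w 0)" "tpow (i - 1)" t] cl quad.Units_closed[OF t_unit]
      by (simp add: add.commute)
    moreover have "(w 1, w 0) \<otimes>\<^bsub>quad\<^esub> tpow (i - 1) \<in> carrier quad" "(w (i - 1 + 1), w (i - 1)) \<in> carrier quad"
      using quad.m_closed[of "(w 1, w 0)" "tpow (i - 1)"] cl by auto
    ultimately show ?case
      by (metis quad.Units_l_cancel quad.m_comm quad.Units_closed t_unit)
  qed
qed

text \<open>The explicit solution with initial terms \<open>x\<close>. It replaces the description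
  operator in \<open>lrec_of_init\<close> and makes existence and uniqueness immediate.\<close>

definition seq :: "'a \<times> 'a \<Rightarrow> int \<Rightarrow> 'a" where
  "seq x n = snd (x \<otimes>\<^bsub>quad\<^esub> tpow n)"

lemma mult_tpow_Suc:
  assumes "x \<in> carrier R \<times> carrier R"
  shows "x \<otimes>\<^bsub>quad\<^esub> tpow (n + 1) = (x \<otimes>\<^bsub>quad\<^esub> tpow n) \<otimes>\<^bsub>quad\<^esub> t"
  using quad.m_assoc[of x "tpow n" t] quad.Units_closed[OF t_unit] assms by (simp add: tpow_add tpow_1)

lemma seq_pair:
  assumes "x \<in> carrier R \<times> carrier R"
  shows "(seq x (n + 1), seq x n) = x \<otimes>\<^bsub>quad\<^esub> tpow n"
proof -
  have "x \<otimes>\<^bsub>quad\<^esub> tpow n \<in> carrier R \<times> carrier R"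
    using quad.m_closed[of x "tpow n"] assms by simp
  then show ?thesis
    using mult_tpow_Suc[OF assms, of n] by (cases "x \<otimes>\<^bsub>quad\<^esub> tpow n") (simp add: seq_def mult_t)
qed

lemma seq_closed:
  assumes "x \<in> carrier R \<times> carrier R"
  shows "seq x n \<in> carrier R"
  using quad.m_closed[of x "tpow n"] assms seq_pair[OF assms, of n] by (metis carrier_quad mem_Sigma_iff tpow_closed)

lemma seq_in_lrec_seqs:
  assumes "x \<in> carrier R \<times> carrier R"
  shows "seq x \<in> lrec_seqs R P Q"
proof -
  have "seq x (n + 2) \<ominus> P \<otimes> seq x (n + 1) \<oplus> Q \<otimes> seq x n = \<zero>" for n
  proof -
    have "(seq x (n + 2), seq x (n + 1)) = (seq x (n + 1), seq x n) \<otimes>\<^bsub>quad\<^esub> t"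
      using seq_pair[OF assms, of "n + 1"] seq_pair[OF assms, of n] mult_tpow_Suc[OF assms, of n] by (simp add: add.assoc)
    then have "seq x (n + 2) = P \<otimes> seq x (n + 1) \<ominus> Q \<otimes> seq x n"
      using mult_t[OF seq_closed[OF assms] seq_closed[OF assms]] by simp
    moreover have "P \<otimes> a \<ominus> Q \<otimes> b \<ominus> P \<otimes> a \<oplus> Q \<otimes> b = \<zero>" if "a \<in> carrier R" "b \<in> carrier R" for a b
      using that P_closed Q_closed by algebra
    ultimately show ?thesis using seq_closed[OF assms] by simp
  qed
  then show ?thesis by (simp add: lrec_seqs_def seq_closed[OF assms])
qed

lemma seq_init:
  assumes "(a, b) \<in> carrier R \<times> carrier R"
  shows "seq (a, b) 1 = a" "seq (a, b) 0 = b"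
  using seq_pair[OF assms, of 0] quad.r_one[of "(a, b)"] assms by (simp_all add: tpow_0 del: int_pow_0)

lemma lrec_seqs_eq_seq:
  assumes "w \<in> lrec_seqs R P Q"
  shows "w = seq (w 1, w 0)"
proof
  fix n show "w n = seq (w 1, w 0) n"
    using lrec_seqs_pair[OF assms, of n] by (metis seq_def snd_conv)
qed

lemma lrec_of_init_eq_seq:
  assumes "a \<in> carrier R" "b \<in> carrier R"
  shows "lrec_of_init R P Q a b = seq (a, b)"
  unfolding lrec_of_init_def
  using assms seq_in_lrec_seqs[of "(a, b)"] seq_init[of a b] lrec_seqs_eq_seq by (intro the_equality) auto

text \<open>Both operations allowed by \<open>lrec_equiv\<close> become multiplication by a fixed
  unit, so its classes will be cosets.\<close>

lemma seq_scale_shift: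
  assumes "x \<in> carrier R \<times> carrier R" "c \<in> carrier R"
  shows "(\<lambda>n. c \<otimes> seq x (n + \<nu>)) = seq (((c, \<zero>) \<otimes>\<^bsub>quad\<^esub> tpow \<nu>) \<otimes>\<^bsub>quad\<^esub> x)"
proof
  fix n
  have c: "(c, \<zero>) \<in> carrier quad" using assms by simp
  have scale: "snd ((c, \<zero>) \<otimes>\<^bsub>quad\<^esub> y) = c \<otimes> snd y" if "y \<in> carrier R \<times> carrier R" for y
  proof -
    obtain a b where y: "y = (a, b)" by (cases y)
    have "a \<in> carrier R" "b \<in> carrier R" using that y by auto
    then have "\<zero> \<otimes> a \<oplus> c \<otimes> b \<ominus> P \<otimes> \<zero> \<otimes> b = c \<otimes> b"
      using assms(2) P_closed by algebra
    then show ?thesis by (simp add: y)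
  qed
  have "((c, \<zero>) \<otimes>\<^bsub>quad\<^esub> tpow \<nu> \<otimes>\<^bsub>quad\<^esub> x) \<otimes>\<^bsub>quad\<^esub> tpow n = (c, \<zero>) \<otimes>\<^bsub>quad\<^esub> (x \<otimes>\<^bsub>quad\<^esub> tpow (n + \<nu>))"
    using assms c tpow_closed[of n] tpow_closed[of \<nu>] unfolding tpow_add carrier_quad[symmetric]
    by (simp add: quad.m_ac del: carrier_quad mult_quad)
  then show "c \<otimes> seq x (n + \<nu>) = seq ((c, \<zero>) \<otimes>\<^bsub>quad\<^esub> tpow \<nu> \<otimes>\<^bsub>quad\<^esub> x) n"
    using scale[of "x \<otimes>\<^bsub>quad\<^esub> tpow (n + \<nu>)"] quad.m_closed[of x "tpow (n + \<nu>)"] assms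
    by (simp add: seq_def del: mult_quad)
qed

end

section \<open>\<open>Gstar\<close> as a quotient of the unit group\<close>

context lrec begin

declare mult_quad [simp del]

definition scalars :: "('a \<times> 'a) set" where
  "scalars = (\<lambda>c. (c, \<zero>)) ` Units R"

text \<open>These are the multipliers that appear in \<open>seq_scale_shift\<close>;
  \<open>Gstar\<close> will be identified with \<open>U Mod S\<close>.\<close>

definition S :: "('a \<times> 'a) set" where
  "S = scalars <#>\<^bsub>U\<^esub> generate U {t}"

lemma carrier_U [simp]: "carrier U = Units quad"
  and mult_U [simp]: "x \<otimes>\<^bsub>U\<^esub> y = x \<otimes>\<^bsub>quad\<^esub> y"
  and one_U [simp]: "\<one>\<^bsub>U\<^esub> = (\<one>, \<zero>)"
  by (simp_all add: units_of_def)

lemma scalar_hom: "(\<lambda>c. (c, \<zero>)) \<in> hom (units_of R) U"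
proof (rule homI)
  fix c d assume "c \<in> carrier (units_of R)" "d \<in> carrier (units_of R)"
  then have cd: "c \<in> Units R" "d \<in> Units R" by (simp_all add: units_of_def)
  then have cl: "c \<in> carrier R" "d \<in> carrier R" by auto
  have "nrm c \<zero> = c \<otimes> c"
    using cl by (simp add: nrm_eq_mult minus_eq)
  then show "(c, \<zero>) \<in> carrier U"
    using cd cl by (simp add: Units_quad)
  show "(c \<otimes>\<^bsub>units_of R\<^esub> d, \<zero>) = (c, \<zero>) \<otimes>\<^bsub>U\<^esub> (d, \<zero>)"
    using cl by (simp add: units_of_def minus_eq mult_quad)
qed

lemma scalars_subgroup: "subgroup scalars U"
proof -
  interpret UR: comm_group "units_of R"
    by (rule units_comm_group)
  interpret group_hom "units_of R" U "\<lambda>c. (c, \<zero>)"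
    by unfold_locales (rule scalar_hom)
  show ?thesis
    using img_is_subgroup by (simp add: scalars_def units_of_def)
qed

lemma S_subgroup: "subgroup S U"
  unfolding S_def
  using U.mult_norm_subgroup[of scalars "generate U {t}"] scalars_subgroup
    U.generate_is_subgroup[of "{t}"] t_unit by (simp add: U.normal_iff_subgroup)

lemma S_alt: "S = {(c, \<zero>) \<otimes>\<^bsub>quad\<^esub> tpow n | c n. c \<in> Units R}"
  using t_unit U.generate_pow[of t] unfolding S_def scalars_def set_mult_def
  by simp blast

lemma lrec_units_eq: "lrec_units R P Q = seq ` Units quad"
proof (intro equalityI subsetI)
  fix w assume w: "w \<in> lrec_units R P Q"
  then have "(w 1, w 0) \<in> Units quad" "w = seq (w 1, w 0)"
    using lrec_seqs_eq_seq by (auto simp: lrec_units_def Units_quad lrec_seqs_def)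
  then show "w \<in> seq ` Units quad" by blast
next
  fix w assume "w \<in> seq ` Units quad"
  then obtain a b where "w = seq (a, b)" "(a, b) \<in> Units quad" by auto
  then show "w \<in> lrec_units R P Q"
    using seq_in_lrec_seqs[of "(a, b)"] seq_init[of a b] by (auto simp: lrec_units_def Units_quad)
qed

lemma inj_on_seq: "inj_on seq (Units quad)"
proof (rule inj_onI)
  fix x y assume "x \<in> Units quad" "y \<in> Units quad" "seq x = seq y"
  then show "x = y"
    using seq_init[of "fst x" "snd x"] seq_init[of "fst y" "snd y"]
    by (auto simp: Units_quad)
qed

lemma seq_mult:
  assumes "x \<in> Units quad" "y \<in> Units quad"
  shows "lrec_mult R P Q (seq x) (seq y) = seq (x \<otimes>\<^bsub>quad\<^esub> y)"
proof -
  obtain a b c d where [simp]: "x = (a, b)" "y = (c, d)" by (cases x, cases y)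
  have "a \<in> carrier R" "b \<in> carrier R" "c \<in> carrier R" "d \<in> carrier R"
    using assms by (auto simp: Units_quad)
  then show ?thesis
    by (simp add: lrec_mult_def seq_init lrec_of_init_eq_seq mult_quad)
qed

lemma lrec_equiv_seq:
  assumes "x \<in> Units quad" "y \<in> Units quad"
  shows "(seq x, seq y) \<in> lrec_equiv R P Q \<longleftrightarrow> (\<exists>s\<in>S. x = s \<otimes>\<^bsub>quad\<^esub> y)"
proof -
  have SU: "s \<in> Units quad" if "s \<in> S" for s
    using subgroup.mem_carrier[OF S_subgroup that] by simp
  have y: "y \<in> carrier R \<times> carrier R"
    using quad.Units_closed[OF assms(2)] by simp
  have "(seq x, seq y) \<in> lrec_equiv R P Q \<longleftrightarrow>
    (\<exists>c\<in>Units R. \<exists>\<nu>. seq x = (\<lambda>n. c \<otimes> seq y (n + \<nu>)))"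
    using assms by (auto simp: lrec_equiv_def lrec_units_eq fun_eq_iff)
  also have "\<dots> \<longleftrightarrow> (\<exists>c\<in>Units R. \<exists>\<nu>. seq x = seq (((c, \<zero>) \<otimes>\<^bsub>quad\<^esub> tpow \<nu>) \<otimes>\<^bsub>quad\<^esub> y))"
    by (intro bex_cong refl ex_cong1) (simp add: seq_scale_shift[OF y Units_closed])
  also have "\<dots> \<longleftrightarrow> (\<exists>s\<in>S. seq x = seq (s \<otimes>\<^bsub>quad\<^esub> y))"
    unfolding S_alt by blast
  also have "\<dots> \<longleftrightarrow> (\<exists>s\<in>S. x = s \<otimes>\<^bsub>quad\<^esub> y)"
    using assms SU by (intro bex_cong refl inj_on_eq_iff[OF inj_on_seq]) auto
  finally show ?thesis .
qed

text \<open>Arbitrary sets \<open>Z\<close> are allowed because multiplication in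
  \<open>Gstar\<close> saturates a whole set of products; classes are the case of a singleton. The
  relation writes the known element as a multiple of the unknown one, hence the inverses taken in
  \<open>S\<close>.\<close>

lemma lrec_equiv_Image:
  assumes "Z \<subseteq> Units quad"
  shows "lrec_equiv R P Q `` (seq ` Z) = seq ` (S <#>\<^bsub>U\<^esub> Z)"
proof (intro equalityI subsetI)
  fix v assume "v \<in> lrec_equiv R P Q `` (seq ` Z)"
  then obtain z where z: "z \<in> Z" "(seq z, v) \<in> lrec_equiv R P Q" by blast
  then obtain y where y: "v = seq y" "y \<in> Units quad"
    by (auto simp: lrec_equiv_def lrec_units_eq)
  then obtain s where s: "s \<in> S" "z = s \<otimes>\<^bsub>quad\<^esub> y"
    using z assms lrec_equiv_seq[of z y] by blast
  then have "y = inv\<^bsub>U\<^esub> s \<otimes>\<^bsub>U\<^esub> z"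
    using subgroup.mem_carrier[OF S_subgroup s(1)] y(2) z(1) assms
    by (intro U.inv_solve_left[THEN iffD2]) auto
  moreover have "inv\<^bsub>U\<^esub> s \<in> S"
    using S_subgroup s(1) by (rule subgroup.m_inv_closed)
  ultimately show "v \<in> seq ` (S <#>\<^bsub>U\<^esub> Z)"
    using z(1) y(1) by (force simp: set_mult_def)
next
  fix v assume "v \<in> seq ` (S <#>\<^bsub>U\<^esub> Z)"
  then obtain s z where sz: "s \<in> S" "z \<in> Z" "v = seq (s \<otimes>\<^bsub>U\<^esub> z)"
    by (auto simp: set_mult_def)
  have U: "s \<in> carrier U" "z \<in> carrier U"
    using subgroup.mem_carrier[OF S_subgroup sz(1)] sz(2) assms by auto
  have "z = inv\<^bsub>U\<^esub> s \<otimes>\<^bsub>quad\<^esub> (s \<otimes>\<^bsub>U\<^esub> z)"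
    using U U.m_assoc[of "inv\<^bsub>U\<^esub> s" s z] U.l_inv[of s] U.l_one[of z] U.inv_closed[of s]
    by simp
  moreover have "inv\<^bsub>U\<^esub> s \<in> S"
    using S_subgroup sz(1) by (rule subgroup.m_inv_closed)
  ultimately have "(seq z, v) \<in> lrec_equiv R P Q"
    using lrec_equiv_seq[of z "s \<otimes>\<^bsub>U\<^esub> z"] U sz(3) U.m_closed[OF U] by (metis carrier_U)
  then show "v \<in> lrec_equiv R P Q `` (seq ` Z)"
    using sz(2) by blast
qed

lemma lrec_equiv_Image_singleton:
  assumes "x \<in> Units quad"
  shows "lrec_equiv R P Q `` {seq x} = seq ` (S #>\<^bsub>U\<^esub> x)"
  using lrec_equiv_Image[of "{x}"] assms by (simp add: r_coset_eq_set_mult)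

lemma lrec_class_eq:
  assumes "(a, b) \<in> Units quad"
  shows "lrec_class R P Q a b = seq ` (S #>\<^bsub>U\<^esub> (a, b))"
  using assms lrec_equiv_Image_singleton[OF assms]
  by (simp add: lrec_class_def lrec_of_init_eq_seq Units_quad)

lemma S_normal: "S \<lhd> U"
  using S_subgroup by (simp add: U.normal_iff_subgroup)

lemma seq_image_iso: "(\<lambda>Z. seq ` Z) \<in> iso (U Mod S) (Gstar R P Q)"
proof (rule isoI)
  have sub: "Z \<subseteq> Units quad" if "Z \<in> carrier (U Mod S)" for Z
    using that U.rcosets_part_G[OF S_subgroup] by (auto simp: FactGroup_def)
  have Gc: "carrier (Gstar R P Q) = (\<lambda>Z. seq ` Z) ` carrier (U Mod S)"
    by (simp add: Gstar_def quotient_def lrec_units_eq carrier_FactGroup lrec_equiv_Image_singleton image_image)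
      (auto simp: lrec_equiv_Image_singleton)
  have inj: "inj_on (\<lambda>Z. seq ` Z) (carrier (U Mod S))"
    using sub inj_on_seq by (meson inj_onI inj_on_image_eq_iff)
  then show "bij_betw (\<lambda>Z. seq ` Z) (carrier (U Mod S)) (carrier (Gstar R P Q))"
    by (simp add: bij_betw_def Gc)
  show "(\<lambda>Z. seq ` Z) \<in> hom (U Mod S) (Gstar R P Q)"
  proof (rule homI)
    fix Z Y assume Z: "Z \<in> carrier (U Mod S)" and Y: "Y \<in> carrier (U Mod S)"
    show "seq ` Z \<in> carrier (Gstar R P Q)" using Z by (simp add: Gc)
    have ZY: "Z <#>\<^bsub>U\<^esub> Y \<in> carrier (U Mod S)"
      using Z Y group.is_monoid[OF normal.factorgroup_is_group[OF S_normal]]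
      by (metis monoid.m_closed mult_FactGroup)
    have "(\<exists>w v. u = lrec_mult R P Q w v \<and> w \<in> seq ` Z \<and> v \<in> seq ` Y) \<longleftrightarrow> u \<in> seq ` (Z <#>\<^bsub>U\<^esub> Y)" for u
    proof -
      have "(\<exists>w v. u = lrec_mult R P Q w v \<and> w \<in> seq ` Z \<and> v \<in> seq ` Y) \<longleftrightarrow>
        (\<exists>x\<in>Z. \<exists>y\<in>Y. u = lrec_mult R P Q (seq x) (seq y))"
        by blast
      also have "\<dots> \<longleftrightarrow> (\<exists>x\<in>Z. \<exists>y\<in>Y. u = seq (x \<otimes>\<^bsub>quad\<^esub> y))"
        by (intro bex_cong refl) (simp add: seq_mult subsetD[OF sub[OF Z]] subsetD[OF sub[OF Y]])
      also have "\<dots> \<longleftrightarrow> u \<in> seq ` (Z <#>\<^bsub>U\<^esub> Y)"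
        unfolding set_mult_def mult_U by blast
      finally show ?thesis .
    qed
    then have "{lrec_mult R P Q w v | w v. w \<in> seq ` Z \<and> v \<in> seq ` Y} = seq ` (Z <#>\<^bsub>U\<^esub> Y)"
      by blast
    then have "seq ` Z \<otimes>\<^bsub>Gstar R P Q\<^esub> seq ` Y = seq ` (S <#>\<^bsub>U\<^esub> (Z <#>\<^bsub>U\<^esub> Y))"
      using lrec_equiv_Image[OF sub[OF ZY]] by (simp add: Gstar_def)
    \<comment> \<open>A product of two cosets is already a coset of \<open>S\<close>, so the
      saturation in the definition of \<open>Gstar\<close> adds nothing.\<close>
    also have "S <#>\<^bsub>U\<^esub> (Z <#>\<^bsub>U\<^esub> Y) = Z <#>\<^bsub>U\<^esub> Y"
      using normal.rcosets_mult_eq[OF S_normal, of "Z <#>\<^bsub>U\<^esub> Y"] ZY by (simp add: FactGroup_def)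
    finally show "seq ` (Z \<otimes>\<^bsub>U Mod S\<^esub> Y) = seq ` Z \<otimes>\<^bsub>Gstar R P Q\<^esub> seq ` Y"
      by simp
  qed
qed

text \<open>Transport of the group structure along an isomorphism gives a group whose
  \<open>one\<close> is the image of the old one; this lemma identifies it with the
  \<open>one\<close> recorded in \<open>Gstar\<close>.\<close>

lemma one_Gstar: "\<one>\<^bsub>Gstar R P Q\<^esub> = seq ` S"
proof -
  have "lrec_class R P Q \<one> \<zero> = seq ` (S #>\<^bsub>U\<^esub> (\<one>, \<zero>))"
    using U.one_closed by (intro lrec_class_eq) simp
  then show ?thesis
    using U.coset_mult_one[of S] subgroup.subset[OF S_subgroup] by (simp add: Gstar_def)
qed

lemma group_Gstar: "group (Gstar R P Q)"
  using group.iso_imp_img_group[OF normal.factorgroup_is_group[OF S_normal] seq_image_iso]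
  by (simp flip: one_Gstar)

lemma trivial_Gstar:
  assumes "Units quad \<subseteq> S"
  shows "trivial_group (Gstar R P Q)"
proof -
  have S: "S = Units quad"
    using assms subgroup.subset[OF S_subgroup] by auto
  have "carrier (Gstar R P Q) = (\<lambda>Z. seq ` Z) ` carrier (U Mod S)"
    using seq_image_iso by (simp add: iso_def bij_betw_def)
  also have "carrier (U Mod S) = {S}"
    using U.coset_join2[OF _ S_subgroup] U.one_closed S by (auto simp: carrier_FactGroup)
  finally show ?thesis
    by (simp add: trivial_group_def group_Gstar one_Gstar)
qed

text \<open>As the kernel of \<open>g\<close> lies in \<open>S\<close>, the full preimage of
  \<open>N = g(S)\<close> is \<open>S\<close>. The composite from \<open>U\<close> to
  \<open>M Mod N\<close> therefore has kernel exactly \<open>S\<close>, and the first isomorphism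
  theorem applies.\<close>

lemma Gstar_iso_viaI:
  assumes M: "comm_group M"
    and g: "(\<lambda>(a, b). g a b) \<in> hom U M"
    and onto: "(\<lambda>(a, b). g a b) ` Units quad = carrier M"
    and N: "N = (\<lambda>(a, b). g a b) ` S"
    and ker: "kernel U M (\<lambda>(a, b). g a b) \<subseteq> S"
  shows "Gstar_iso_via R P Q M N g"
proof -
  define G where "G = (\<lambda>(a, b). g a b)"
  interpret M: comm_group M by (fact M)
  interpret G: group_hom U M G
    using g by unfold_locales (simp add: G_def)
  have N_sub: "subgroup N M"
    using G.subgroup_img_is_subgroup[OF S_subgroup] N by (simp add: G_def)
  have N_normal: "N \<lhd> M"
    using N_sub by (simp add: M.normal_iff_subgroup)
  interpret MN: group "M Mod N"
    using N_normal by (rule normal.factorgroup_is_group)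
  define k where "k = (\<lambda>x. N #>\<^bsub>M\<^esub> G x)"
  have "k \<in> hom U (M Mod N)"
    using hom_compose[OF G.homh normal.r_coset_hom_Mod[OF N_normal]] by (simp add: k_def comp_def)
  then interpret k: group_hom U "M Mod N" k
    by unfold_locales
  have "G x \<in> N \<longleftrightarrow> x \<in> S" if x: "x \<in> Units quad" for x
  proof
    assume "G x \<in> N"
    then obtain s where s: "s \<in> S" "G x = G s" by (auto simp: N G_def)
    then have sU: "s \<in> carrier U" using subgroup.mem_carrier[OF S_subgroup] by blast
    have "G (x \<otimes>\<^bsub>U\<^esub> inv\<^bsub>U\<^esub> s) = \<one>\<^bsub>M\<^esub>"
      using x s sU G.hom_mult[of x "inv\<^bsub>U\<^esub> s"] G.hom_inv[OF sU] G.hom_closed[OF sU] U.inv_closed[OF sU]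
      by simp
    then have "x \<otimes>\<^bsub>U\<^esub> inv\<^bsub>U\<^esub> s \<in> S"
      using ker U.m_closed[of x "inv\<^bsub>U\<^esub> s"] x U.inv_closed[OF sU] unfolding kernel_def G_def by auto
    then have "x \<otimes>\<^bsub>U\<^esub> inv\<^bsub>U\<^esub> s \<otimes>\<^bsub>U\<^esub> s \<in> S"
      using subgroup.m_closed[OF S_subgroup] s(1) by blast
    then show "x \<in> S"
      using U.m_assoc[of x "inv\<^bsub>U\<^esub> s" s] U.l_inv[OF sU] U.r_one[of x] x sU U.inv_closed[OF sU]
      by (simp del: mult_U one_U)
  qed (use N G_def in blast)
  moreover have "k x = N \<longleftrightarrow> G x \<in> N" if "x \<in> Units quad" for x
    using M.coset_join1[OF _ _ N_sub, of "G x"] M.coset_join2[OF _ N_sub, of "G x"] G.hom_closed[of x] that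
    unfolding k_def by auto
  ultimately have kerk: "kernel U (M Mod N) k = S"
    using subgroup.subset[OF S_subgroup] unfolding kernel_def carrier_U one_FactGroup by blast
  have "k ` carrier U = carrier (M Mod N)"
    using onto by (auto simp: carrier_FactGroup k_def G_def image_image simp flip: onto)
  then have "(\<lambda>Z. the_elem (k ` Z)) \<in> iso (U Mod S) (M Mod N)"
    using k.FactGroup_iso_set by (simp add: kerk)
  moreover have "inv_into (carrier (U Mod S)) (\<lambda>Z. seq ` Z) \<in> iso (Gstar R P Q) (U Mod S)"
    using group.iso_set_sym[OF normal.factorgroup_is_group[OF S_normal] seq_image_iso] .
  ultimately have iso: "(\<lambda>Z. the_elem (k ` Z)) \<circ> inv_into (carrier (U Mod S)) (\<lambda>Z. seq ` Z) \<in> iso (Gstar R P Q) (M Mod N)"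
    (is "?\<phi> \<in> _")
    using iso_set_trans by blast
  have "?\<phi> (lrec_class R P Q a b) = N #>\<^bsub>M\<^esub> g a b"
    if "a \<in> carrier R" "b \<in> carrier R" "nrm a b \<in> Units R" for a b
  proof -
    have u: "(a, b) \<in> Units quad" using that by (simp add: Units_quad)
    have Z: "S #>\<^bsub>U\<^esub> (a, b) \<in> carrier (U Mod S)"
      using u by (auto simp: carrier_FactGroup)
    have "inv_into (carrier (U Mod S)) (\<lambda>Z. seq ` Z) (lrec_class R P Q a b) = S #>\<^bsub>U\<^esub> (a, b)"
      unfolding lrec_class_eq[OF u]
      using seq_image_iso Z by (intro inv_into_f_f) (auto simp: iso_def bij_betw_def)
    \<comment> \<open>The value given by \<open>the_elem\<close> is known only once \<open>k\<close>
      is constant on the coset, which holds because \<open>S\<close> is its kernel.\<close>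
    moreover have "k ` (S #>\<^bsub>U\<^esub> (a, b)) = {k (a, b)}"
    proof -
      have "k x = k (a, b)" if x: "x \<in> S #>\<^bsub>U\<^esub> (a, b)" for x
      proof -
        obtain s where s: "s \<in> S" "x = s \<otimes>\<^bsub>U\<^esub> (a, b)"
          using x by (auto simp: r_coset_def)
        have "s \<in> kernel U (M Mod N) k" using s kerk by simp
        then have "s \<in> carrier U" "k s = \<one>\<^bsub>M Mod N\<^esub>" by (auto simp: kernel_def)
        then show ?thesis
          using k.hom_mult[of s "(a, b)"] u k.hom_closed[of "(a, b)"] MN.l_one[of "k (a, b)"] s(2)
          by simp
      qed
      moreover have "(a, b) \<in> S #>\<^bsub>U\<^esub> (a, b)"
        using U.rcos_self[OF _ S_subgroup] u by simp
      ultimately show ?thesis by blast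
    qed
    ultimately show ?thesis by (simp add: k_def G_def)
  qed
  then show ?thesis
    unfolding Gstar_iso_via_def using group_Gstar N_normal iso by blast
qed

end

section \<open>Generators of subgroups and identities for linear factors\<close>

text \<open>The reason is \<open>x = (x y) y^(-1)\<close> with \<open>x y\<close> in
  \<open>C\<close>. With the scalars as \<open>C\<close> it exchanges the shift for a more
  convenient generator, such as \<theta>1 for \<theta>2.\<close>

lemma (in comm_group) set_mult_generate_mono:
  assumes C: "subgroup C G" and x: "x \<in> carrier G" and y: "y \<in> carrier G" and xy: "x \<otimes> y \<in> C"
  shows "C <#> generate G {x} \<subseteq> C <#> generate G {y}"
proof -
  have gy: "subgroup (generate G {y}) G"
    using y by (simp add: generate_is_subgroup)
  let ?K = "C <#> generate G {y}"
  have K: "subgroup ?K G"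
    using mult_norm_subgroup[of C "generate G {y}"] C gy by (simp add: normal_iff_subgroup)
  have CK: "c \<in> ?K" if "c \<in> C" for c
    using that subgroup.one_closed[OF gy] subgroup.mem_carrier[OF C that]
    unfolding set_mult_def by (intro UN_I[of c] UN_I[of \<one>]) simp_all
  have "x = (x \<otimes> y) \<otimes> inv y"
    using x y by (simp add: m_assoc)
  moreover have "inv y \<in> generate G {y}"
    by (simp add: generate.inv)
  ultimately have "x \<in> ?K"
    using xy unfolding set_mult_def by blast
  then have "generate G {x} \<subseteq> ?K"
    using K by (intro generate_subgroup_incl) auto
  then have "c \<otimes> z \<in> ?K" if "c \<in> C" "z \<in> generate G {x}" for c z
    using subgroup.m_closed[OF K CK[OF that(1)]] that(2) by blast
  then show ?thesis
    by (auto simp: set_mult_def[of _ C "generate G {x}"])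
qed

lemma (in comm_group) set_mult_generate_eq:
  assumes "subgroup C G" "x \<in> carrier G" "y \<in> carrier G" "x \<otimes> y \<in> C"
  shows "C <#> generate G {x} = C <#> generate G {y}"
  using set_mult_generate_mono[of C x y] set_mult_generate_mono[of C y x] assms
  by (simp add: m_comm)

lemma (in comm_group) subgroup_imp_comm_group:
  assumes "subgroup H G"
  shows "comm_group (G\<lparr>carrier := H\<rparr>)"
  using subgroup_imp_group[OF assms] subgroup.mem_carrier[OF assms] m_comm
  by (intro group.group_comm_groupI) auto

lemma (in monoid) inv_mult_Units:
  "x \<in> Units G \<Longrightarrow> y \<in> Units G \<Longrightarrow> inv (x \<otimes> y) = inv y \<otimes> inv x"
  using group.inv_mult_group[OF units_group, of x y]
  by (simp add: units_of_carrier units_of_mult units_of_inv)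

text \<open>Evaluation at a root \<open>x\<close> is multiplicative. Writing
  \<open>P = x + y\<close> and \<open>Q = x y\<close> makes the relation
  \<open>x^2 = P x - Q\<close> an identity, so the method \<open>algebra\<close> proves it without
  side conditions.\<close>

lemma (in cring) linear_factor_mult:
  assumes "a \<in> carrier R" "b \<in> carrier R" "c \<in> carrier R" "d \<in> carrier R" "x \<in> carrier R" "y \<in> carrier R"
  shows "(a \<otimes> c \<ominus> (x \<otimes> y) \<otimes> b \<otimes> d) \<ominus> (b \<otimes> c \<oplus> a \<otimes> d \<ominus> (x \<oplus> y) \<otimes> b \<otimes> d) \<otimes> x =
    (a \<ominus> b \<otimes> x) \<otimes> (c \<ominus> d \<otimes> x)"
  using assms by algebra

lemma (in cring) norm_eq_linear_factors:
  assumes "a \<in> carrier R" "b \<in> carrier R" "x \<in> carrier R" "y \<in> carrier R"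
  shows "a [^] (2::nat) \<ominus> (x \<oplus> y) \<otimes> b \<otimes> a \<oplus> (x \<otimes> y) \<otimes> b [^] (2::nat) = (a \<ominus> b \<otimes> x) \<otimes> (a \<ominus> b \<otimes> y)"
  using assms by (simp add: numeral_2_eq_2) algebra

section \<open>Evaluation at the roots in a field\<close>

text \<open>One setting for all three coefficient rings: \<open>h\<close> is \<open>of_rat\<close>
  into the complex numbers for the rationals and the local ring, and a given homomorphism into a
  field for the residue field. The roots enter through their sum and product, which keeps the
  assumptions symmetric.\<close>

locale lrec_roots = lrec R P Q + L: field L
  for R :: "('a, 'b) ring_scheme" (structure) and P Q
    and L :: "'l ring" +
  fixes h :: "'a \<Rightarrow> 'l" and \<theta>1 \<theta>2 :: 'l
  assumes h_hom: "h \<in> ring_hom R L"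
    and h_inj: "inj_on h (carrier R)"
    and \<theta>1_closed [simp, intro]: "\<theta>1 \<in> carrier L"
    and \<theta>2_closed [simp, intro]: "\<theta>2 \<in> carrier L"
    and h_P: "h P = \<theta>1 \<oplus>\<^bsub>L\<^esub> \<theta>2"
    and h_Q: "h Q = \<theta>1 \<otimes>\<^bsub>L\<^esub> \<theta>2"
begin

text \<open>Facts about evaluation at \<theta>1 become facts about \<theta>2 by interpreting the
  locale with the roots exchanged; for this reason \<open>lin\<close> takes the root as an
  argument.\<close>

lemma lrec_roots_swap: "lrec_roots R P Q L h \<theta>2 \<theta>1"
  using h_hom h_inj h_P h_Q by unfold_locales (simp_all add: L.a_comm L.m_comm)

lemma ring_hom_ring_h: "ring_hom_ring R L h"
  using h_hom by (intro ring_hom_ringI2 ring_axioms L.ring_axioms)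

sublocale h: ring_hom_ring R L h
  by (rule ring_hom_ring_h)

lemma h_closed [simp]: "a \<in> carrier R \<Longrightarrow> h a \<in> carrier L"
  using h_hom by (rule ring_hom_closed)

lemma h_minus: "a \<in> carrier R \<Longrightarrow> b \<in> carrier R \<Longrightarrow> h (a \<ominus> b) = h a \<ominus>\<^bsub>L\<^esub> h b"
  by (simp add: a_minus_def)

lemma h_eq_iff: "a \<in> carrier R \<Longrightarrow> b \<in> carrier R \<Longrightarrow> h a = h b \<longleftrightarrow> a = b"
  using h_inj by (auto simp: inj_on_def)

definition lin :: "'l \<Rightarrow> 'a \<times> 'a \<Rightarrow> 'l" where
  "lin \<theta> = (\<lambda>(a, b). h a \<ominus>\<^bsub>L\<^esub> h b \<otimes>\<^bsub>L\<^esub> \<theta>)"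

lemma lin_closed [simp]: "x \<in> carrier quad \<Longrightarrow> \<theta> \<in> carrier L \<Longrightarrow> lin \<theta> x \<in> carrier L"
  by (auto simp: lin_def)

lemma lin_mult:
  assumes "x \<in> carrier quad" "y \<in> carrier quad"
  shows "lin \<theta>1 (x \<otimes>\<^bsub>quad\<^esub> y) = lin \<theta>1 x \<otimes>\<^bsub>L\<^esub> lin \<theta>1 y"
proof -
  obtain a b c d where [simp]: "x = (a, b)" "y = (c, d)" by (cases x, cases y)
  have "a \<in> carrier R" "b \<in> carrier R" "c \<in> carrier R" "d \<in> carrier R"
    using assms by auto
  then show ?thesis
    using L.linear_factor_mult[of "h a" "h b" "h c" "h d" \<theta>1 \<theta>2]
    by (simp add: lin_def mult_quad h_minus h_P h_Q)
qed

lemma lin_one: "lin \<theta>1 (\<one>, \<zero>) = \<one>\<^bsub>L\<^esub>"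
  by (simp add: lin_def L.minus_eq)

lemma lin_scalar: "c \<in> carrier R \<Longrightarrow> lin \<theta>1 (c, \<zero>) = h c"
  by (simp add: lin_def L.minus_eq)

text \<open>Evaluation at \<theta>1 sends the shift to the other root. This mismatch with the stated
  subgroups is what \<open>set_mult_generate_eq\<close> repairs.\<close>

lemma lin_t: "lin \<theta>1 t = \<theta>2"
proof -
  have "\<theta>1 \<oplus>\<^bsub>L\<^esub> \<theta>2 \<ominus>\<^bsub>L\<^esub> \<theta>1 = \<theta>2"
    using \<theta>1_closed \<theta>2_closed by algebra
  then show ?thesis by (simp add: lin_def t_def h_P)
qed

lemma lin_unit: "x \<in> Units quad \<Longrightarrow> lin \<theta>1 x \<in> Units L"
  using lin_mult[of x "inv\<^bsub>quad\<^esub> x"] lin_one lin_closed[of x \<theta>1] lin_closed[of "inv\<^bsub>quad\<^esub> x" \<theta>1]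
    quad.Units_r_inv[of x] quad.Units_closed[of x] quad.Units_inv_closed[of x] L.Units_one_closed
  by (metis L.unit_factor \<theta>1_closed one_quad)

lemma lin_hom: "lin \<theta>1 \<in> hom U (units_of L)"
  by (rule homI) (simp_all add: lin_unit lin_mult quad.Units_closed units_of_mult units_of_carrier del: carrier_quad)

lemma h_norm: "a \<in> carrier R \<Longrightarrow> b \<in> carrier R \<Longrightarrow> h (nrm a b) = lin \<theta>1 (a, b) \<otimes>\<^bsub>L\<^esub> lin \<theta>2 (a, b)"
  using L.norm_eq_linear_factors[of "h a" "h b" \<theta>1 \<theta>2]
  by (simp add: lrec_norm_def lin_def h_minus h_P h_Q h.hom_nat_pow)

text \<open>Common core of both kinds of isomorphism. Taking the image of \<open>g\<close> as the
  target makes surjectivity automatic and leaves two tasks: the kernel, and the description of that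
  image. The unit \<open>(a, b)\<close> replaces \<open>t\<close> as generator so that the subgroup
  has the desired name.\<close>

lemma Gstar_iso_via_image:
  assumes M: "M = (units_of L)\<lparr>carrier := (\<lambda>(a, b). g a b) ` Units quad\<rparr>"
    and g: "(\<lambda>(a, b). g a b) \<in> hom U (units_of L)"
    and x: "(a, b) \<in> Units quad" "(a, b) \<otimes>\<^bsub>quad\<^esub> t \<in> scalars"
    and ker: "\<And>a b. (a, b) \<in> Units quad \<Longrightarrow> g a b = \<one>\<^bsub>L\<^esub> \<Longrightarrow> (a, b) \<in> S"
  shows "Gstar_iso_via R P Q M (((\<lambda>(a, b). g a b) ` scalars) <#>\<^bsub>M\<^esub> generate M {g a b}) g"
proof -
  let ?g = "\<lambda>(a, b). g a b"
  interpret UL: comm_group "units_of L"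
    by (rule L.units_comm_group)
  interpret g: group_hom U "units_of L" ?g
    using g by unfold_locales
  have "subgroup (?g ` Units quad) (units_of L)"
    using g.img_is_subgroup by simp
  then interpret M: comm_group M
    unfolding M by (rule UL.subgroup_imp_comm_group)
  have gM: "?g \<in> hom U M"
    using g by (auto simp: M hom_def)
  interpret gM: group_hom U M ?g
    using gM by unfold_locales
  have "S = scalars <#>\<^bsub>U\<^esub> generate U {(a, b)}"
    unfolding S_def using U.set_mult_generate_eq[OF scalars_subgroup, of "(a, b)" t] x t_unit by simp
  then have "?g ` S = ?g ` scalars <#>\<^bsub>M\<^esub> ?g ` generate U {(a, b)}"
    using set_mult_hom[OF gM, of scalars "generate U {(a, b)}"] subgroup.subset[OF scalars_subgroup]
      U.generate_incl[of "{(a, b)}"] x(1) by simp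
  also have "?g ` generate U {(a, b)} = generate M {g a b}"
    using gM.generate_img[of "{(a, b)}"] x(1) by simp
  finally have N: "?g ` scalars <#>\<^bsub>M\<^esub> generate M {g a b} = ?g ` S" ..
  show ?thesis
    unfolding N
    by (rule Gstar_iso_viaI[OF M.comm_group_axioms gM]) (auto simp: M kernel_def units_of_one ker)
qed

text \<open>This is the ring generated by \<open>h R\<close> and \<theta>1: as \<theta>1 satisfies a
  monic quadratic equation, no higher powers occur.\<close>

definition ext :: "'l set" where
  "ext = lin \<theta>1 ` carrier quad"

lemma lin_add:
  assumes "a \<in> carrier R" "b \<in> carrier R" "c \<in> carrier R" "d \<in> carrier R"
  shows "lin \<theta>1 (a, b) \<oplus>\<^bsub>L\<^esub> lin \<theta>1 (c, d) = lin \<theta>1 (a \<oplus> c, b \<oplus> d)"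
proof -
  have "(x \<ominus>\<^bsub>L\<^esub> y \<otimes>\<^bsub>L\<^esub> \<theta>1) \<oplus>\<^bsub>L\<^esub> (z \<ominus>\<^bsub>L\<^esub> w \<otimes>\<^bsub>L\<^esub> \<theta>1) = (x \<oplus>\<^bsub>L\<^esub> z) \<ominus>\<^bsub>L\<^esub> (y \<oplus>\<^bsub>L\<^esub> w) \<otimes>\<^bsub>L\<^esub> \<theta>1"
    if "x \<in> carrier L" "y \<in> carrier L" "z \<in> carrier L" "w \<in> carrier L" for x y z w
    using that \<theta>1_closed by algebra
  then show ?thesis
    using assms by (simp add: lin_def)
qed

lemma \<theta>1_eq_lin: "\<theta>1 = lin \<theta>1 (\<zero>, \<ominus> \<one>)"
proof -
  have "\<theta>1 = \<zero>\<^bsub>L\<^esub> \<ominus>\<^bsub>L\<^esub> (\<ominus>\<^bsub>L\<^esub> \<one>\<^bsub>L\<^esub>) \<otimes>\<^bsub>L\<^esub> \<theta>1"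
    using \<theta>1_closed by algebra
  then show ?thesis by (simp add: lin_def)
qed

lemma ext_subring: "subring ext L"
proof (rule L.subringI)
  show "ext \<subseteq> carrier L"
    by (auto simp: ext_def)
  show "\<one>\<^bsub>L\<^esub> \<in> ext"
    unfolding ext_def using lin_one by (metis image_eqI one_quad quad.one_closed)
  show mult: "x \<otimes>\<^bsub>L\<^esub> y \<in> ext" if xy: "x \<in> ext" "y \<in> ext" for x y
  proof -
    obtain u v where uv: "x = lin \<theta>1 u" "y = lin \<theta>1 v" "u \<in> carrier quad" "v \<in> carrier quad"
      using xy unfolding ext_def by blast
    then have "x \<otimes>\<^bsub>L\<^esub> y = lin \<theta>1 (u \<otimes>\<^bsub>quad\<^esub> v)" "u \<otimes>\<^bsub>quad\<^esub> v \<in> carrier quad"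
      using lin_mult[OF uv(3,4)] quad.m_closed[OF uv(3,4)] by simp_all
    then show ?thesis unfolding ext_def by blast
  qed
  show "x \<oplus>\<^bsub>L\<^esub> y \<in> ext" if "x \<in> ext" "y \<in> ext" for x y
    using that by (auto simp: ext_def lin_add)
  show "\<ominus>\<^bsub>L\<^esub> x \<in> ext" if "x \<in> ext" for x
  proof -
    have "lin \<theta>1 (\<ominus> \<one>, \<zero>) \<in> ext" by (simp add: ext_def)
    then have "\<ominus>\<^bsub>L\<^esub> \<one>\<^bsub>L\<^esub> \<in> ext" by (simp add: lin_scalar)
    then have "(\<ominus>\<^bsub>L\<^esub> \<one>\<^bsub>L\<^esub>) \<otimes>\<^bsub>L\<^esub> x \<in> ext" using mult that by blast
    moreover have "x \<in> carrier L" using that by (auto simp: ext_def)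
    ultimately show ?thesis by (simp add: L.l_minus)
  qed
qed

lemma ext_incl: "insert \<theta>1 (h ` carrier R) \<subseteq> ext"
  using \<theta>1_eq_lin lin_scalar unfolding ext_def
  by (auto intro!: image_eqI[of \<theta>1 _ "(\<zero>, \<ominus> \<one>)"] simp flip: lin_scalar)

lemma ext_min: "subring K L \<Longrightarrow> insert \<theta>1 (h ` carrier R) \<subseteq> K \<Longrightarrow> ext \<subseteq> K"
proof
  fix x assume K: "subring K L" "insert \<theta>1 (h ` carrier R) \<subseteq> K" and "x \<in> ext"
  then obtain a b where x: "x = h a \<ominus>\<^bsub>L\<^esub> h b \<otimes>\<^bsub>L\<^esub> \<theta>1" "a \<in> carrier R" "b \<in> carrier R"
    by (auto simp: ext_def lin_def)
  then have "h a \<in> K" "h b \<in> K" "\<theta>1 \<in> K" using K(2) by auto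
  then show "x \<in> K"
    unfolding x L.minus_eq by (intro subringE(5-7)[OF K(1)])
qed

lemma generate_ring_eq: "generate_ring L (insert \<theta>1 (h ` carrier R)) = ext"
  using ext_subring ext_incl ext_min
  by (intro L.generate_ringI[symmetric]) auto

lemma Units_image: "Units (L\<lparr>carrier := h ` carrier R\<rparr>) = h ` Units R"
proof (intro equalityI subsetI)
  fix x assume "x \<in> Units (L\<lparr>carrier := h ` carrier R\<rparr>)"
  then obtain a b where ab: "x = h a" "a \<in> carrier R" "b \<in> carrier R" "h a \<otimes>\<^bsub>L\<^esub> h b = \<one>\<^bsub>L\<^esub>"
    by (auto simp: Units_def)
  then have "h (a \<otimes> b) = h \<one>" by simp
  then have "a \<otimes> b = \<one>" using ab by (subst (asm) h_eq_iff) auto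
  then have "a \<in> Units R" using ab by (metis Units_one_closed unit_factor)
  then show "x \<in> h ` Units R" using ab by simp
next
  fix x assume "x \<in> h ` Units R"
  then obtain a where a: "x = h a" "a \<in> Units R" by auto
  then have "h a \<otimes>\<^bsub>L\<^esub> h (inv a) = \<one>\<^bsub>L\<^esub>" "h (inv a) \<otimes>\<^bsub>L\<^esub> h a = \<one>\<^bsub>L\<^esub>"
    using h.hom_mult[of a "inv a"] h.hom_mult[of "inv a" a] by (simp_all add: Units_closed)
  then show "x \<in> Units (L\<lparr>carrier := h ` carrier R\<rparr>)"
    unfolding Units_def using a Units_closed[OF a(2)] Units_inv_closed[OF a(2)] by auto
qed

section \<open>Case of independent \<open>1\<close> and \<theta>1: the extension ring\<close>

context
  assumes indep: "\<And>a b. a \<in> carrier R \<Longrightarrow> b \<in> carrier R \<Longrightarrow> h a = h b \<otimes>\<^bsub>L\<^esub> \<theta>1 \<Longrightarrow> b = \<zero>"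
begin

lemma lin_inj: "inj_on (lin \<theta>1) (carrier quad)"
proof (rule inj_onI)
  fix x y assume "x \<in> carrier quad" "y \<in> carrier quad" and eq: "lin \<theta>1 x = lin \<theta>1 y"
  then obtain a b c d where [simp]: "x = (a, b)" "y = (c, d)"
    and cl: "a \<in> carrier R" "b \<in> carrier R" "c \<in> carrier R" "d \<in> carrier R" by auto
  have "(u \<ominus>\<^bsub>L\<^esub> w) = (v \<ominus>\<^bsub>L\<^esub> z) \<otimes>\<^bsub>L\<^esub> \<theta>1" if "u \<ominus>\<^bsub>L\<^esub> v \<otimes>\<^bsub>L\<^esub> \<theta>1 = w \<ominus>\<^bsub>L\<^esub> z \<otimes>\<^bsub>L\<^esub> \<theta>1"
    "u \<in> carrier L" "v \<in> carrier L" "w \<in> carrier L" "z \<in> carrier L" for u v w z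
  proof -
    have "(u \<ominus>\<^bsub>L\<^esub> w) \<ominus>\<^bsub>L\<^esub> (v \<ominus>\<^bsub>L\<^esub> z) \<otimes>\<^bsub>L\<^esub> \<theta>1 = (u \<ominus>\<^bsub>L\<^esub> v \<otimes>\<^bsub>L\<^esub> \<theta>1) \<ominus>\<^bsub>L\<^esub> (w \<ominus>\<^bsub>L\<^esub> z \<otimes>\<^bsub>L\<^esub> \<theta>1)"
      using that(2-) \<theta>1_closed by algebra
    also have "\<dots> = \<zero>\<^bsub>L\<^esub>" using that by simp
    finally show ?thesis using that(2-) by - (rule L.r_right_minus_eq[THEN iffD1], simp_all)
  qed
  from this[of "h a" "h b" "h c" "h d"] have "h (a \<ominus> c) = h (b \<ominus> d) \<otimes>\<^bsub>L\<^esub> \<theta>1"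
    using eq cl by (simp add: lin_def h_minus)
  then have "b \<ominus> d = \<zero>"
    using indep[of "a \<ominus> c" "b \<ominus> d"] cl by simp
  then have "b = d" using cl by simp
  then have "h a = h c"
    using eq cl by (simp add: lin_def L.minus_eq)
  then show "x = y" using \<open>b = d\<close> cl h_eq_iff by simp
qed

text \<open>Independence makes evaluation injective, so an inverse found inside \<open>ext\<close>
  pulls back to an inverse in \<open>quad\<close>.\<close>

lemma Units_ext: "Units (L\<lparr>carrier := ext\<rparr>) = lin \<theta>1 ` Units quad"
proof (intro equalityI subsetI)
  fix x assume "x \<in> Units (L\<lparr>carrier := ext\<rparr>)"
  then obtain u v where uv: "x = lin \<theta>1 u" "u \<in> carrier quad" "v \<in> carrier quad"
    "lin \<theta>1 u \<otimes>\<^bsub>L\<^esub> lin \<theta>1 v = \<one>\<^bsub>L\<^esub>"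
    by (auto simp: Units_def ext_def simp del: carrier_quad)
  then have "lin \<theta>1 (u \<otimes>\<^bsub>quad\<^esub> v) = lin \<theta>1 \<one>\<^bsub>quad\<^esub>"
    by (simp add: lin_mult lin_one del: carrier_quad)
  then have "u \<otimes>\<^bsub>quad\<^esub> v = \<one>\<^bsub>quad\<^esub>"
    using uv by (intro inj_onD[OF lin_inj]) (auto simp del: carrier_quad one_quad)
  then have "u \<in> Units quad" using uv by (metis quad.Units_one_closed quad.unit_factor)
  then show "x \<in> lin \<theta>1 ` Units quad" using uv by simp
next
  fix x assume "x \<in> lin \<theta>1 ` Units quad"
  then obtain u where u: "x = lin \<theta>1 u" "u \<in> Units quad" by auto
  let ?v = "inv\<^bsub>quad\<^esub> u"
  have v: "?v \<in> carrier quad" "u \<in> carrier quad" using u quad.Units_closed by auto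
  have "lin \<theta>1 u \<otimes>\<^bsub>L\<^esub> lin \<theta>1 ?v = \<one>\<^bsub>L\<^esub>" "lin \<theta>1 ?v \<otimes>\<^bsub>L\<^esub> lin \<theta>1 u = \<one>\<^bsub>L\<^esub>"
    using lin_mult[OF v] lin_mult[OF v(2,1)] lin_one u(2) by simp_all
  moreover have "lin \<theta>1 u \<in> ext" "lin \<theta>1 ?v \<in> ext" using v unfolding ext_def by blast+
  ultimately show "x \<in> Units (L\<lparr>carrier := ext\<rparr>)"
    using u(1) by (auto simp: Units_def)
qed

theorem Gstar_iso_via_ext:
  assumes M: "M = units_of (L\<lparr>carrier := ext\<rparr>)"
  shows "Gstar_iso_via R P Q M (times_cyclic M (h ` Units R) \<theta>1) (\<lambda>a b. h a \<ominus>\<^bsub>L\<^esub> h b \<otimes>\<^bsub>L\<^esub> \<theta>1)"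
proof -
  have M': "M = (units_of L)\<lparr>carrier := (\<lambda>(a, b). h a \<ominus>\<^bsub>L\<^esub> h b \<otimes>\<^bsub>L\<^esub> \<theta>1) ` Units quad\<rparr>"
    unfolding M lin_def[symmetric] Units_ext[symmetric] by (simp add: units_of_def)
  \<comment> \<open>The pair \<open>(0, -1)\<close> evaluates to \<theta>1. Its norm is
    \<open>Q\<close> and its product with \<open>t\<close> is the scalar \<open>Q\<close>, so it can
    replace \<open>t\<close> as generator.\<close>
  have "nrm \<zero> (\<ominus> \<one>) = Q"
    using P_closed Q_closed by (simp add: nrm_eq_mult minus_eq l_minus r_minus r_neg)
  then have x: "(\<zero>, \<ominus> \<one>) \<in> Units quad"
    using Q_unit by (simp add: Units_quad)
  have "P \<otimes> \<zero> \<ominus> Q \<otimes> (\<ominus> \<one>) = Q"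
    by (simp add: minus_eq r_minus)
  then have xt: "(\<zero>, \<ominus> \<one>) \<otimes>\<^bsub>quad\<^esub> t \<in> scalars"
    using Q_unit by (auto simp: mult_t scalars_def)
  have "Gstar_iso_via R P Q M (((\<lambda>(a, b). h a \<ominus>\<^bsub>L\<^esub> h b \<otimes>\<^bsub>L\<^esub> \<theta>1) ` scalars) <#>\<^bsub>M\<^esub>
    generate M {h \<zero> \<ominus>\<^bsub>L\<^esub> h (\<ominus> \<one>) \<otimes>\<^bsub>L\<^esub> \<theta>1}) (\<lambda>a b. h a \<ominus>\<^bsub>L\<^esub> h b \<otimes>\<^bsub>L\<^esub> \<theta>1)"
  proof (rule Gstar_iso_via_image[OF M' _ x xt])
    show "(\<lambda>(a, b). h a \<ominus>\<^bsub>L\<^esub> h b \<otimes>\<^bsub>L\<^esub> \<theta>1) \<in> hom U (units_of L)"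
      using lin_hom by (simp add: lin_def)
    fix a b assume ab: "(a, b) \<in> Units quad" "h a \<ominus>\<^bsub>L\<^esub> h b \<otimes>\<^bsub>L\<^esub> \<theta>1 = \<one>\<^bsub>L\<^esub>"
    then have "lin \<theta>1 (a, b) = lin \<theta>1 (\<one>, \<zero>)" by (simp add: lin_one) (simp add: lin_def)
    then have "(a, b) = (\<one>, \<zero>)"
      using quad.Units_closed[OF ab(1)] by (intro inj_onD[OF lin_inj]) auto
    then show "(a, b) \<in> S"
      using subgroup.one_closed[OF S_subgroup] by simp
  qed
  moreover have "(\<lambda>(a, b). h a \<ominus>\<^bsub>L\<^esub> h b \<otimes>\<^bsub>L\<^esub> \<theta>1) ` scalars = h ` Units R"
    unfolding scalars_def image_image by (intro image_cong refl) (simp add: L.minus_eq Units_closed)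
  moreover have "h \<zero> \<ominus>\<^bsub>L\<^esub> h (\<ominus> \<one>) \<otimes>\<^bsub>L\<^esub> \<theta>1 = \<theta>1"
    using \<theta>1_eq_lin by (simp add: lin_def)
  ultimately show ?thesis by (simp add: times_cyclic_def)
qed

text \<open>Over a field, \<open>ext\<close> is closed under inverses because a nonzero element has
  nonzero norm: from \<open>a - b \<theta>2 = 0\<close> and \<open>\<theta>2 = P - \<theta>1\<close>
  one gets \<open>a - P b = - b \<theta>1\<close>, and independence forces \<open>b = 0\<close>,
  then \<open>a = 0\<close>.\<close>

lemma generate_field_eq:
  assumes field: "\<And>a. a \<in> carrier R \<Longrightarrow> a \<noteq> \<zero> \<Longrightarrow> a \<in> Units R"
  shows "generate_field L (insert \<theta>1 (h ` carrier R)) = ext"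
proof (rule L.generate_fieldI[symmetric])
  show "insert \<theta>1 (h ` carrier R) \<subseteq> carrier L" by auto
  show "insert \<theta>1 (h ` carrier R) \<subseteq> ext" by (rule ext_incl)
  show "ext \<subseteq> K" if "subfield K L" "insert \<theta>1 (h ` carrier R) \<subseteq> K" for K
    using ext_min subfieldE(1)[OF that(1)] that(2) by blast
  show "subfield ext L"
  proof (rule L.subfieldI'[OF ext_subring])
    fix k assume "k \<in> ext - {\<zero>\<^bsub>L\<^esub>}"
    then obtain a b where ab: "a \<in> carrier R" "b \<in> carrier R" and k: "k = lin \<theta>1 (a, b)" "k \<noteq> \<zero>\<^bsub>L\<^esub>"
      by (auto simp: ext_def)
    have "lin \<theta>2 (a, b) \<noteq> \<zero>\<^bsub>L\<^esub>"
    proof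
      assume "lin \<theta>2 (a, b) = \<zero>\<^bsub>L\<^esub>"
      then have *: "h a \<ominus>\<^bsub>L\<^esub> h b \<otimes>\<^bsub>L\<^esub> \<theta>2 = \<zero>\<^bsub>L\<^esub>" by (simp add: lin_def)
      have "(x \<ominus>\<^bsub>L\<^esub> (\<theta>1 \<oplus>\<^bsub>L\<^esub> \<theta>2) \<otimes>\<^bsub>L\<^esub> y) = (\<ominus>\<^bsub>L\<^esub> y) \<otimes>\<^bsub>L\<^esub> \<theta>1" if "x \<ominus>\<^bsub>L\<^esub> y \<otimes>\<^bsub>L\<^esub> \<theta>2 = \<zero>\<^bsub>L\<^esub>"
        "x \<in> carrier L" "y \<in> carrier L" for x y
      proof -
        have "(x \<ominus>\<^bsub>L\<^esub> (\<theta>1 \<oplus>\<^bsub>L\<^esub> \<theta>2) \<otimes>\<^bsub>L\<^esub> y) \<ominus>\<^bsub>L\<^esub> (\<ominus>\<^bsub>L\<^esub> y) \<otimes>\<^bsub>L\<^esub> \<theta>1 = x \<ominus>\<^bsub>L\<^esub> y \<otimes>\<^bsub>L\<^esub> \<theta>2"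
          using that(2-) \<theta>1_closed \<theta>2_closed by algebra
        then show ?thesis using that by - (rule L.r_right_minus_eq[THEN iffD1], simp_all)
      qed
      from this[OF *] have "h (a \<ominus> P \<otimes> b) = h (\<ominus> b) \<otimes>\<^bsub>L\<^esub> \<theta>1"
        using ab by (simp add: h_minus h_P)
      then have "\<ominus> b = \<zero>" using indep[of "a \<ominus> P \<otimes> b" "\<ominus> b"] ab by simp
      then have "b = \<zero>" using ab by (metis minus_minus minus_zero)
      with * ab have "h a = \<zero>\<^bsub>L\<^esub>" by (simp add: L.minus_eq)
      with k \<open>b = \<zero>\<close> ab show False by (simp add: lin_scalar)
    qed
    then have "h (nrm a b) \<noteq> \<zero>\<^bsub>L\<^esub>"
      using k ab by (simp add: h_norm L.integral_iff)
    then have "nrm a b \<in> Units R"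
      using field[of "nrm a b"] ab by (cases "nrm a b = \<zero>") auto
    then have u: "(a, b) \<in> Units quad" using ab by (simp add: Units_quad)
    let ?v = "inv\<^bsub>quad\<^esub> (a, b)"
    have v: "?v \<in> carrier quad" "(a, b) \<in> carrier quad" using u quad.Units_closed by auto
    have "lin \<theta>1 (a, b) \<otimes>\<^bsub>L\<^esub> lin \<theta>1 ?v = \<one>\<^bsub>L\<^esub>"
      using lin_mult[OF v(2,1)] lin_one u by simp
    then have "inv\<^bsub>L\<^esub> k = lin \<theta>1 ?v"
      using k v by (intro L.comm_inv_char) (auto simp del: carrier_quad)
    then show "inv\<^bsub>L\<^esub> k \<in> ext" using v(1) unfolding ext_def by blast
  qed
qed

end

section \<open>Case of distinct roots: the quotient of the two evaluations\<close>

context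
  assumes \<theta>_neq: "\<theta>1 \<noteq> \<theta>2"
begin

interpretation swap: lrec_roots R P Q L h \<theta>2 \<theta>1
  by (rule lrec_roots_swap)

abbreviation ratio :: "'a \<Rightarrow> 'a \<Rightarrow> 'l" where
  "ratio a b \<equiv> (h a \<ominus>\<^bsub>L\<^esub> h b \<otimes>\<^bsub>L\<^esub> \<theta>1) \<otimes>\<^bsub>L\<^esub> inv\<^bsub>L\<^esub> (h a \<ominus>\<^bsub>L\<^esub> h b \<otimes>\<^bsub>L\<^esub> \<theta>2)"

text \<open>Quotient \<open>1\<close> means \<open>b (\<theta>1 - \<theta>2) = 0\<close>, hence
  \<open>b = 0\<close>: the kernel consists of scalars. Scalars in turn have quotient
  \<open>1\<close>, so only the cyclic factor of \<open>S\<close> survives in the image. The target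
  stays an abstract image here and is computed separately for each ring.\<close>

theorem Gstar_iso_via_ratio:
  assumes M: "M = (units_of L)\<lparr>carrier := (\<lambda>(a, b). ratio a b) ` Units quad\<rparr>"
  shows "Gstar_iso_via R P Q M (generate M {\<theta>1 \<otimes>\<^bsub>L\<^esub> inv\<^bsub>L\<^esub> \<theta>2}) ratio"
proof -
  interpret UL: comm_group "units_of L"
    by (rule L.units_comm_group)
  have rl: "(\<lambda>(a, b). ratio a b) = (\<lambda>x. lin \<theta>1 x \<otimes>\<^bsub>L\<^esub> inv\<^bsub>L\<^esub> (lin \<theta>2 x))"
    by (auto simp: lin_def)
  have hom: "(\<lambda>x. lin \<theta>1 x \<otimes>\<^bsub>L\<^esub> inv\<^bsub>L\<^esub> (lin \<theta>2 x)) \<in> hom U (units_of L)"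
  proof (rule homI)
    fix x y assume "x \<in> carrier U" "y \<in> carrier U"
    then have xy: "x \<in> Units quad" "y \<in> Units quad" "x \<in> carrier quad" "y \<in> carrier quad"
      using quad.Units_closed by simp_all
    note u = lin_unit[OF xy(1)] lin_unit[OF xy(2)] swap.lin_unit[OF xy(1)] swap.lin_unit[OF xy(2)]
    then show "lin \<theta>1 x \<otimes>\<^bsub>L\<^esub> inv\<^bsub>L\<^esub> (lin \<theta>2 x) \<in> carrier (units_of L)"
      by (simp add: units_of_carrier)
    have "inv\<^bsub>L\<^esub> (lin \<theta>2 x \<otimes>\<^bsub>L\<^esub> lin \<theta>2 y) = inv\<^bsub>L\<^esub> (lin \<theta>2 y) \<otimes>\<^bsub>L\<^esub> inv\<^bsub>L\<^esub> (lin \<theta>2 x)"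
      using u by (simp add: L.inv_mult_Units)
    then show "lin \<theta>1 (x \<otimes>\<^bsub>U\<^esub> y) \<otimes>\<^bsub>L\<^esub> inv\<^bsub>L\<^esub> (lin \<theta>2 (x \<otimes>\<^bsub>U\<^esub> y)) =
      lin \<theta>1 x \<otimes>\<^bsub>L\<^esub> inv\<^bsub>L\<^esub> (lin \<theta>2 x) \<otimes>\<^bsub>units_of L\<^esub> (lin \<theta>1 y \<otimes>\<^bsub>L\<^esub> inv\<^bsub>L\<^esub> (lin \<theta>2 y))"
      using u xy by (simp add: lin_mult swap.lin_mult L.m_ac units_of_mult del: carrier_quad)
  qed
  interpret g: group_hom U "units_of L" "\<lambda>x. lin \<theta>1 x \<otimes>\<^bsub>L\<^esub> inv\<^bsub>L\<^esub> (lin \<theta>2 x)"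
    using hom by unfold_locales
  have \<theta>u: "\<theta>2 \<in> Units L" "\<theta>1 \<in> Units L"
    using lin_unit[OF t_unit] swap.lin_unit[OF t_unit] by (simp_all add: lin_t swap.lin_t)
  \<comment> \<open>The shift has quotient \<open>\<theta>2 / \<theta>1\<close>; its inverse gives
    the generator \<open>\<theta>1 / \<theta>2\<close> as stated.\<close>
  obtain a b where ab: "inv\<^bsub>U\<^esub> t = (a, b)" by (cases "inv\<^bsub>U\<^esub> t")
  have x: "(a, b) \<in> Units quad" "(a, b) \<otimes>\<^bsub>quad\<^esub> t \<in> scalars"
    using U.inv_closed[of t] U.l_inv[of t] t_unit subgroup.one_closed[OF scalars_subgroup]
    by (simp_all flip: ab)
  have "ratio a b = lin \<theta>1 (inv\<^bsub>U\<^esub> t) \<otimes>\<^bsub>L\<^esub> inv\<^bsub>L\<^esub> (lin \<theta>2 (inv\<^bsub>U\<^esub> t))"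
    using fun_cong[OF rl, of "(a, b)"] by (simp add: ab)
  also have "\<dots> = inv\<^bsub>units_of L\<^esub> (\<theta>2 \<otimes>\<^bsub>L\<^esub> inv\<^bsub>L\<^esub> \<theta>1)"
    using g.hom_inv[of t] t_unit by (simp add: lin_t swap.lin_t)
  also have "\<dots> = \<theta>1 \<otimes>\<^bsub>L\<^esub> inv\<^bsub>L\<^esub> \<theta>2"
    using \<theta>u by (simp add: L.units_of_inv L.inv_mult_Units)
  finally have gx: "ratio a b = \<theta>1 \<otimes>\<^bsub>L\<^esub> inv\<^bsub>L\<^esub> \<theta>2" .
  have "Gstar_iso_via R P Q M (((\<lambda>(a, b). ratio a b) ` scalars) <#>\<^bsub>M\<^esub> generate M {ratio a b}) ratio"
  proof (rule Gstar_iso_via_image[OF M _ x])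
    show "(\<lambda>(a, b). ratio a b) \<in> hom U (units_of L)"
      unfolding rl by (rule hom)
    fix a b assume ab: "(a, b) \<in> Units quad" and 1: "ratio a b = \<one>\<^bsub>L\<^esub>"
    have cl: "a \<in> carrier R" "b \<in> carrier R" and u: "nrm a b \<in> Units R"
      using ab by (auto simp: Units_quad)
    have "lin \<theta>1 (a, b) \<in> Units L" "lin \<theta>2 (a, b) \<in> Units L"
      using lin_unit[OF ab] swap.lin_unit[OF ab] by simp_all
    moreover have "lin \<theta>1 (a, b) \<otimes>\<^bsub>L\<^esub> inv\<^bsub>L\<^esub> (lin \<theta>2 (a, b)) = \<one>\<^bsub>L\<^esub>"
      using 1 by (simp add: lin_def)
    ultimately have eq: "h a \<ominus>\<^bsub>L\<^esub> h b \<otimes>\<^bsub>L\<^esub> \<theta>1 = h a \<ominus>\<^bsub>L\<^esub> h b \<otimes>\<^bsub>L\<^esub> \<theta>2"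
      using L.Units_closed L.inv_char L.Units_inv_inv L.Units_inv_closed L.comm_inv_char unfolding lin_def prod.case
      by (metis L.Units_inv_Units L.inv_unique' L.m_comm)
    have "x \<otimes>\<^bsub>L\<^esub> (\<theta>1 \<ominus>\<^bsub>L\<^esub> \<theta>2) = \<zero>\<^bsub>L\<^esub>" if "y \<ominus>\<^bsub>L\<^esub> x \<otimes>\<^bsub>L\<^esub> \<theta>1 = y \<ominus>\<^bsub>L\<^esub> x \<otimes>\<^bsub>L\<^esub> \<theta>2" "x \<in> carrier L" "y \<in> carrier L" for x y
    proof -
      have "x \<otimes>\<^bsub>L\<^esub> (\<theta>1 \<ominus>\<^bsub>L\<^esub> \<theta>2) = (y \<ominus>\<^bsub>L\<^esub> x \<otimes>\<^bsub>L\<^esub> \<theta>2) \<ominus>\<^bsub>L\<^esub> (y \<ominus>\<^bsub>L\<^esub> x \<otimes>\<^bsub>L\<^esub> \<theta>1)"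
        using that(2-) \<theta>1_closed \<theta>2_closed by algebra
      then show ?thesis using that by simp
    qed
    from this[OF eq] have "h b = \<zero>\<^bsub>L\<^esub>"
      using cl \<theta>_neq by (simp add: L.integral_iff)
    then have b: "b = \<zero>" using cl h_eq_iff[of b \<zero>] by simp
    have "nrm a \<zero> = a \<otimes> a"
      using cl P_closed Q_closed by (simp add: nrm_eq_mult minus_eq l_minus r_minus r_neg)
    then have "a \<in> Units R" using u b cl by (metis unit_factor)
    then have "(a, b) \<in> scalars" by (simp add: scalars_def b)
    moreover have "(\<one>, \<zero>) \<in> generate U {t}" using generate.one[of U] by simp
    ultimately have "(a, b) \<otimes>\<^bsub>U\<^esub> (\<one>, \<zero>) \<in> S" unfolding S_def set_mult_def by blast
    then show "(a, b) \<in> S" using U.r_one[of "(a, b)"] ab by simp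
  qed
  moreover have "(\<lambda>(a, b). ratio a b) ` scalars <#>\<^bsub>M\<^esub> generate M {ratio a b} = generate M {ratio a b}"
  proof -
    have "ratio c \<zero> = \<one>\<^bsub>L\<^esub>" if "c \<in> Units R" for c
      using lin_unit[of "(c, \<zero>)"] subgroup.mem_carrier[OF scalars_subgroup, of "(c, \<zero>)"] that
      by (simp add: scalars_def lin_scalar L.minus_eq Units_closed)
    \<comment> \<open>There is at least one scalar, so the image is the singleton of one and not
      empty.\<close>
    moreover have "\<one> \<in> Units R" by simp
    ultimately have im: "(\<lambda>(a, b). ratio a b) ` scalars = {\<one>\<^bsub>L\<^esub>}"
      unfolding scalars_def image_image by force
    interpret M: group M
      unfolding M rl using UL.subgroup_imp_group[of "(\<lambda>x. lin \<theta>1 x \<otimes>\<^bsub>L\<^esub> inv\<^bsub>L\<^esub> (lin \<theta>2 x)) ` Units quad"] g.img_is_subgroup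
      by simp
    have "\<one>\<^bsub>L\<^esub> = \<one>\<^bsub>M\<^esub>" by (simp add: M units_of_one)
    moreover have "generate M {ratio a b} \<subseteq> carrier M"
      using x(1) by (intro M.generate_incl) (auto simp: M intro!: image_eqI[of _ _ "(a, b)"])
    ultimately show ?thesis
      unfolding im by (force simp: set_mult_def)
  qed
  ultimately show ?thesis unfolding gx by simp
qed

end

end

section \<open>Quadratic polynomials: factors and irreducibility\<close>

lemma (in domain) poly_mult_monic_linear:
  assumes "a \<in> carrier R" "b \<in> carrier R"
  shows "[\<one>, \<ominus> a] \<otimes>\<^bsub>poly_ring R\<^esub> [\<one>, \<ominus> b] = [\<one>, \<ominus> (a \<oplus> b), a \<otimes> b]"
proof -
  have "\<ominus> a \<otimes> \<ominus> b = a \<otimes> b" "\<ominus> b \<oplus> \<ominus> a = \<ominus> (a \<oplus> b)"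
    using assms by (algebra, algebra)
  \<comment> \<open>Coefficient lists drop leading zeros, so the simplification of the product
    splits on whether \<open>a\<close> vanishes.\<close>
  moreover have "\<ominus> a = \<zero> \<longleftrightarrow> a = \<zero>"
    using assms by (metis minus_minus minus_zero)
  ultimately show ?thesis
    using assms by (auto simp: univ_poly_mult)
qed

lemma (in domain) has_roots2_iff:
  assumes "P \<in> carrier R" "Q \<in> carrier R"
  shows "has_roots2 R P Q a b \<longleftrightarrow> a \<in> carrier R \<and> b \<in> carrier R \<and> P = a \<oplus> b \<and> Q = a \<otimes> b"
proof (cases "a \<in> carrier R \<and> b \<in> carrier R")
  case True
  then have "\<ominus> P = \<ominus> (a \<oplus> b) \<longleftrightarrow> P = a \<oplus> b"
    using assms by (metis a_closed minus_minus)
  with True assms show ?thesis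
    by (simp add: has_roots2_def char_poly2_def poly_mult_monic_linear)
qed (auto simp: has_roots2_def)

text \<open>A proper factorization of a quadratic has a factor of degree one, which has a root over
  a field. Irreducibility in the polynomial ring thus becomes a statement about elements of the
  coefficient field.\<close>

lemma (in field) irreducible2_iff:
  assumes P: "P \<in> carrier R" and Q: "Q \<in> carrier R"
  shows "irreducible2 R P Q \<longleftrightarrow> (\<forall>r \<in> carrier R. r \<otimes> r \<ominus> P \<otimes> r \<oplus> Q \<noteq> \<zero>)"
proof
  let ?f = "char_poly2 R P Q"
  have sf: "subfield (carrier R) R" by (rule carrier_is_subfield)
  have f: "?f \<in> carrier (poly_ring R)" "?f \<noteq> []" "length ?f - 1 = 2"
    using P Q by (auto simp: char_poly2_def polynomial_def simp flip: univ_poly_carrier)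
  show "\<forall>r \<in> carrier R. r \<otimes> r \<ominus> P \<otimes> r \<oplus> Q \<noteq> \<zero>" if irr: "irreducible2 R P Q"
  proof (intro ballI notI)
    fix r assume r: "r \<in> carrier R" and 0: "r \<otimes> r \<ominus> P \<otimes> r \<oplus> Q = \<zero>"
    have "P = r \<oplus> (P \<ominus> r)"
      using P r by algebra
    moreover have "Q = (r \<otimes> r \<ominus> P \<otimes> r \<oplus> Q) \<oplus> r \<otimes> (P \<ominus> r)"
      using P Q r by algebra
    then have "Q = r \<otimes> (P \<ominus> r)"
      using P r by (simp add: 0)
    ultimately have "has_roots2 R P Q r (P \<ominus> r)"
      using P Q r has_roots2_iff by simp
    then have "?f = [\<one>, \<ominus> r] \<otimes>\<^bsub>poly_ring R\<^esub> [\<one>, \<ominus> (P \<ominus> r)]"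
      by (simp add: has_roots2_def)
    moreover have "[\<one>, \<ominus> r] \<in> carrier (poly_ring R)" "[\<one>, \<ominus> (P \<ominus> r)] \<in> carrier (poly_ring R)"
      using P r by (auto simp: polynomial_def simp flip: univ_poly_carrier)
    ultimately have "[\<one>, \<ominus> r] \<in> Units (poly_ring R) \<or> [\<one>, \<ominus> (P \<ominus> r)] \<in> Units (poly_ring R)"
      using pirreducibleE(3)[OF carrier_is_subring f(1)] irr unfolding irreducible2_def by blast
    then show False
      by (simp add: univ_poly_units'[OF sf])
  qed
  show "irreducible2 R P Q" if noroot: "\<forall>r \<in> carrier R. r \<otimes> r \<ominus> P \<otimes> r \<oplus> Q \<noteq> \<zero>"
    unfolding irreducible2_def
  proof (rule pirreducibleI[OF carrier_is_subring f(1,2)])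
    show "?f \<notin> Units (poly_ring R)"
      using f by (simp add: univ_poly_units'[OF sf])
    fix q r assume q: "q \<in> carrier (poly_ring R)" and r: "r \<in> carrier (poly_ring R)"
      and fqr: "?f = q \<otimes>\<^bsub>poly_ring R\<^esub> r"
    have deg: "q \<noteq> []" "r \<noteq> []" "(length q - 1) + (length r - 1) = 2"
      using poly_mult_degree_eq[OF carrier_is_subring, of q r] q r fqr f(3)
      by (auto simp: univ_poly_carrier univ_poly_mult split: if_splits)
    have "length q - 1 \<noteq> 1"
    proof
      assume "length q - 1 = 1"
      define x where "x = \<ominus> (inv (hd q) \<otimes> const_term q)"
      have x: "x \<in> carrier R" "eval q x = \<zero>"
        using degree_one_root[OF sf q \<open>length q - 1 = 1\<close>] unfolding x_def by auto
      have "set q \<subseteq> carrier R" "set r \<subseteq> carrier R"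
        using q r by (auto simp: polynomial_def simp flip: univ_poly_carrier)
      then have "eval ?f x = \<zero>"
        using eval_poly_mult[of q r x] x eval_in_carrier[of r x] by (simp add: fqr univ_poly_mult)
      then have "\<one> \<otimes> x [^] (2::nat) \<oplus> (\<ominus> P \<otimes> x [^] (1::nat) \<oplus> (Q \<otimes> x [^] (0::nat) \<oplus> \<zero>)) = \<zero>"
        by (simp add: char_poly2_def numeral_2_eq_2)
      moreover have "x \<otimes> x \<ominus> P \<otimes> x \<oplus> Q = \<one> \<otimes> x [^] (2::nat) \<oplus> (\<ominus> P \<otimes> x [^] (1::nat) \<oplus> (Q \<otimes> x [^] (0::nat) \<oplus> \<zero>))"
        using P Q x(1) by (simp add: numeral_2_eq_2, algebra)
      ultimately show False
        using noroot x(1) by auto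
    qed
    then have "length q - 1 = 0 \<or> length r - 1 = 0" using deg(3) by linarith
    then show "q \<in> Units (poly_ring R) \<or> r \<in> Units (poly_ring R)"
      using q r deg(1,2) by (auto simp: univ_poly_units'[OF sf])
  qed
qed

text \<open>Needed to pass from \<open>inv\<close> of the complex field, taken as a ring, to the
  function \<open>inverse\<close>: the two are known to agree only away from zero, and unit norm
  keeps the denominators nonzero.\<close>

lemma Gstar_iso_via_cong:
  assumes "\<And>w1 w0. w1 \<in> carrier R \<Longrightarrow> w0 \<in> carrier R \<Longrightarrow> lrec_norm R P Q w1 w0 \<in> Units R \<Longrightarrow> g w1 w0 = g' w1 w0"
  shows "Gstar_iso_via R P Q M N g \<longleftrightarrow> Gstar_iso_via R P Q M N g'"
  using assms unfolding Gstar_iso_via_def by (metis (no_types, lifting))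

section \<open>Roots inside and outside the coefficient ring\<close>

context lrec_roots begin

text \<open>In the field \<open>L\<close> the image of \<open>r\<close> must be one of the two
  roots, and \<open>P - r\<close> then maps to the other. A single root in \<open>R\<close> thus
  brings both into \<open>R\<close>.\<close>

lemma root_imp_theta:
  assumes r: "r \<in> carrier R" and root: "r \<otimes> r \<ominus> P \<otimes> r \<oplus> Q = \<zero>"
  shows "\<exists>r1\<in>carrier R. \<exists>r2\<in>carrier R. h r1 = \<theta>1 \<and> h r2 = \<theta>2"
proof -
  have "h r \<otimes>\<^bsub>L\<^esub> h r \<ominus>\<^bsub>L\<^esub> (\<theta>1 \<oplus>\<^bsub>L\<^esub> \<theta>2) \<otimes>\<^bsub>L\<^esub> h r \<oplus>\<^bsub>L\<^esub> \<theta>1 \<otimes>\<^bsub>L\<^esub> \<theta>2 = h \<zero>"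
    unfolding root[symmetric] using r by (simp add: h_minus h_P h_Q)
  moreover have "x \<otimes>\<^bsub>L\<^esub> x \<ominus>\<^bsub>L\<^esub> (\<theta>1 \<oplus>\<^bsub>L\<^esub> \<theta>2) \<otimes>\<^bsub>L\<^esub> x \<oplus>\<^bsub>L\<^esub> \<theta>1 \<otimes>\<^bsub>L\<^esub> \<theta>2 = (x \<ominus>\<^bsub>L\<^esub> \<theta>1) \<otimes>\<^bsub>L\<^esub> (x \<ominus>\<^bsub>L\<^esub> \<theta>2)"
    if "x \<in> carrier L" for x
    using that \<theta>1_closed \<theta>2_closed by algebra
  ultimately have "(h r \<ominus>\<^bsub>L\<^esub> \<theta>1) \<otimes>\<^bsub>L\<^esub> (h r \<ominus>\<^bsub>L\<^esub> \<theta>2) = \<zero>\<^bsub>L\<^esub>"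
    using r by simp
  then have "h r = \<theta>1 \<or> h r = \<theta>2"
    using r by (simp add: L.integral_iff)
  then show ?thesis
  proof
    assume 1: "h r = \<theta>1"
    have "\<theta>1 \<oplus>\<^bsub>L\<^esub> \<theta>2 \<ominus>\<^bsub>L\<^esub> \<theta>1 = \<theta>2"
      using \<theta>1_closed \<theta>2_closed by algebra
    then have "h (P \<ominus> r) = \<theta>2" using r 1 by (simp add: h_minus h_P)
    with 1 r show ?thesis by (intro bexI[of _ r] bexI[of _ "P \<ominus> r"]) simp_all
  next
    assume 2: "h r = \<theta>2"
    have "\<theta>1 \<oplus>\<^bsub>L\<^esub> \<theta>2 \<ominus>\<^bsub>L\<^esub> \<theta>2 = \<theta>1"
      using \<theta>1_closed \<theta>2_closed by algebra
    then have "h (P \<ominus> r) = \<theta>1" using r 2 by (simp add: h_minus h_P)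
    with 2 r show ?thesis by (intro bexI[of _ r] bexI[of _ "P \<ominus> r"]) simp_all
  qed
qed

text \<open>A relation with \<open>b\<close> nonzero would make \<theta>1 the image of
  \<open>a / b\<close>, which would be a root in \<open>R\<close>.\<close>

lemma no_root_imp_indep:
  assumes field: "\<And>a. a \<in> carrier R \<Longrightarrow> a \<noteq> \<zero> \<Longrightarrow> a \<in> Units R"
    and noroot: "\<And>r. r \<in> carrier R \<Longrightarrow> r \<otimes> r \<ominus> P \<otimes> r \<oplus> Q \<noteq> \<zero>"
    and ab: "a \<in> carrier R" "b \<in> carrier R" and eq: "h a = h b \<otimes>\<^bsub>L\<^esub> \<theta>1"
  shows "b = \<zero>"
proof (rule ccontr)
  assume "b \<noteq> \<zero>"
  then have b: "b \<in> Units R" using field ab by simp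
  define r where "r = inv b \<otimes> a"
  have r: "r \<in> carrier R" using b ab by (simp add: r_def)
  have "h r = h (inv b) \<otimes>\<^bsub>L\<^esub> h b \<otimes>\<^bsub>L\<^esub> \<theta>1"
    using b ab by (simp add: r_def eq L.m_assoc)
  also have "h (inv b) \<otimes>\<^bsub>L\<^esub> h b = \<one>\<^bsub>L\<^esub>"
    using b ab h.hom_mult[of "inv b" b] by simp
  finally have hr: "h r = \<theta>1" by simp
  have "h (r \<otimes> r \<ominus> P \<otimes> r \<oplus> Q) = \<theta>1 \<otimes>\<^bsub>L\<^esub> \<theta>1 \<ominus>\<^bsub>L\<^esub> (\<theta>1 \<oplus>\<^bsub>L\<^esub> \<theta>2) \<otimes>\<^bsub>L\<^esub> \<theta>1 \<oplus>\<^bsub>L\<^esub> \<theta>1 \<otimes>\<^bsub>L\<^esub> \<theta>2"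
    using r by (simp add: h_minus hr h_P h_Q)
  also have "\<dots> = \<zero>\<^bsub>L\<^esub>"
    using \<theta>1_closed \<theta>2_closed by algebra
  finally have "h (r \<otimes> r \<ominus> P \<otimes> r \<oplus> Q) = h \<zero>" by simp
  then have "r \<otimes> r \<ominus> P \<otimes> r \<oplus> Q = \<zero>"
    using r by (subst (asm) h_eq_iff) simp_all
  then show False using noroot r by blast
qed

lemma nrm_split:
  assumes "r1 \<in> carrier R" "r2 \<in> carrier R" "h r1 = \<theta>1" "h r2 = \<theta>2" "a \<in> carrier R" "b \<in> carrier R"
  shows "nrm a b = (a \<ominus> b \<otimes> r1) \<otimes> (a \<ominus> b \<otimes> r2)"
proof -
  have "h (nrm a b) = h ((a \<ominus> b \<otimes> r1) \<otimes> (a \<ominus> b \<otimes> r2))"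
    using assms by (simp add: h_norm lin_def h_minus)
  then show ?thesis
    using assms by (subst (asm) h_eq_iff) simp_all
qed

lemma h_inv: "a \<in> Units R \<Longrightarrow> h (inv a) = inv\<^bsub>L\<^esub> (h a)"
  using h.hom_mult[of a "inv a"] by (intro L.comm_inv_char[symmetric]) (simp_all add: Units_closed)

lemma ratio_image:
  assumes r: "r1 \<in> carrier R" "r2 \<in> carrier R" "h r1 = \<theta>1" "h r2 = \<theta>2" and d: "r1 \<ominus> r2 \<in> Units R"
  shows "(\<lambda>(a, b). ratio a b) ` Units quad = h ` Units R"
proof (intro equalityI subsetI)
  fix y assume "y \<in> (\<lambda>(a, b). ratio a b) ` Units quad"
  then obtain a b where y: "y = ratio a b" and u: "(a, b) \<in> Units quad" by auto
  then have ab: "a \<in> carrier R" "b \<in> carrier R" "nrm a b \<in> Units R" by (auto simp: Units_quad)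
  then have u12: "(a \<ominus> b \<otimes> r1) \<in> Units R" "(a \<ominus> b \<otimes> r2) \<in> Units R"
    using nrm_split[OF r ab(1,2)] r
      unit_factor[of "a \<ominus> b \<otimes> r1" "a \<ominus> b \<otimes> r2"] unit_factor[of "a \<ominus> b \<otimes> r2" "a \<ominus> b \<otimes> r1"]
    by (simp_all add: m_comm)
  then have "y = h ((a \<ominus> b \<otimes> r1) \<otimes> inv (a \<ominus> b \<otimes> r2))"
    using ab r u12 by (simp add: y h_inv h_minus)
  moreover have "(a \<ominus> b \<otimes> r1) \<otimes> inv (a \<ominus> b \<otimes> r2) \<in> Units R"
    using u12 by simp
  ultimately show "y \<in> h ` Units R" by blast
next
  fix y assume "y \<in> h ` Units R"
  then obtain u where y: "y = h u" and u: "u \<in> Units R" by auto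
  define i where "i = inv (r1 \<ominus> r2)"
  have i: "i \<in> carrier R" "i \<otimes> (r1 \<ominus> r2) = \<one>" using d by (simp_all add: i_def)
  \<comment> \<open>The pair solves \<open>a - b r2 = 1\<close> and \<open>a - b r1 = u\<close>;
    subtraction gives \<open>b (r1 - r2) = 1 - u\<close>, solvable because \<open>r1 - r2\<close> is
    a unit.\<close>
  define b where "b = (\<one> \<ominus> u) \<otimes> i"
  define a where "a = \<one> \<oplus> b \<otimes> r2"
  have uc: "u \<in> carrier R" using u by (rule Units_closed)
  have cl: "b \<in> carrier R" "a \<in> carrier R" using uc i r by (simp_all add: a_def b_def)
  have a2: "a \<ominus> b \<otimes> r2 = \<one>"
    unfolding a_def using cl(1) r(2) by algebra
  have "a \<ominus> b \<otimes> r1 = \<one> \<ominus> (\<one> \<ominus> u) \<otimes> (i \<otimes> (r1 \<ominus> r2))"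
    unfolding a_def b_def using uc i(1) r(1,2) by algebra
  also have "\<dots> = u"
    unfolding i(2) using uc by algebra
  finally have a1: "a \<ominus> b \<otimes> r1 = u" .
  have "nrm a b = u"
    using nrm_split[OF r cl(2,1)] uc by (simp add: a1 a2)
  then have "(a, b) \<in> Units quad" using u cl by (simp add: Units_quad)
  moreover have "ratio a b = y"
  proof -
    have "ratio a b = h (a \<ominus> b \<otimes> r1) \<otimes>\<^bsub>L\<^esub> inv\<^bsub>L\<^esub> (h (a \<ominus> b \<otimes> r2))"
      using cl r by (simp add: h_minus)
    also have "\<dots> = y" using uc by (simp add: a1 a2 y)
    finally show ?thesis .
  qed
  ultimately show "y \<in> (\<lambda>(a, b). ratio a b) ` Units quad" by force
qed

theorem Gstar_iso_via_split:
  assumes r: "r1 \<in> carrier R" "r2 \<in> carrier R" "h r1 = \<theta>1" "h r2 = \<theta>2" and d: "r1 \<ominus> r2 \<in> Units R"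
    and M: "M = units_of (L\<lparr>carrier := h ` carrier R\<rparr>)"
  shows "Gstar_iso_via R P Q M (generate M {\<theta>1 \<otimes>\<^bsub>L\<^esub> inv\<^bsub>L\<^esub> \<theta>2}) ratio"
proof (rule Gstar_iso_via_ratio)
  show "\<theta>1 \<noteq> \<theta>2"
  proof
    assume "\<theta>1 = \<theta>2"
    then have "h (r1 \<ominus> r2) = \<zero>\<^bsub>L\<^esub>" using r by (simp add: h_minus)
    moreover have "h (r1 \<ominus> r2) \<otimes>\<^bsub>L\<^esub> h (inv (r1 \<ominus> r2)) = \<one>\<^bsub>L\<^esub>"
      using d h.hom_mult[of "r1 \<ominus> r2" "inv (r1 \<ominus> r2)"] r by simp
    ultimately show False using d by simp
  qed
  show "M = (units_of L)\<lparr>carrier := (\<lambda>(a, b). ratio a b) ` Units quad\<rparr>"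
    unfolding ratio_image[OF r d] by (simp add: M units_of_def Units_image)
qed

end

section \<open>Concrete operations: fields as types and the local ring\<close>

lemma type_ring_simps [simp]:
  "carrier ring_of_type_algebra = UNIV"
  "x \<otimes>\<^bsub>ring_of_type_algebra\<^esub> y = x * y"
  "\<one>\<^bsub>ring_of_type_algebra\<^esub> = 1"
  "\<zero>\<^bsub>ring_of_type_algebra\<^esub> = 0"
  "x \<oplus>\<^bsub>ring_of_type_algebra\<^esub> y = x + y"
  by (simp_all add: ring_of_type_algebra_def)

lemma type_ring_a_inv [simp]: "\<ominus>\<^bsub>ring_of_type_algebra\<^esub> (x :: 'a :: field) = - x"
  using abelian_group.minus_equality[OF ring.is_abelian_group[OF field.is_ring[OF field_from_type_algebra]], of "- x" x]
  by simp

lemma type_ring_a_minus [simp]: "(x :: 'a :: field) \<ominus>\<^bsub>ring_of_type_algebra\<^esub> y = x - y"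
  by (simp add: a_minus_def)

lemma type_ring_Units [simp]: "Units (ring_of_type_algebra :: 'a :: field ring) = - {0}"
  using field.field_Units[OF field_from_type_algebra] by auto

lemma type_ring_m_inv [simp]: "x \<noteq> 0 \<Longrightarrow> inv\<^bsub>ring_of_type_algebra\<^esub> (x :: 'a :: field) = inverse x"
  by (rule comm_monoid.comm_inv_char[OF cring.axioms(2)[OF cring_from_type_algebra]]) auto

lemma int_localizedI: "\<not> int p dvd b \<Longrightarrow> of_int a / of_int b \<in> int_localized p"
  unfolding int_localized_def by blast

context
  fixes p :: nat
  assumes p: "Factorial_Ring.prime p"
begin

lemma prime_int_p: "Factorial_Ring.prime (int p)"
  using p by simp

lemma int_localized_of_int [simp]: "of_int a \<in> int_localized p"
  using int_localizedI[of p 1 a] prime_gt_1_nat[OF p] by simp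

lemma int_localized_add:
  assumes "x \<in> int_localized p" "y \<in> int_localized p"
  shows "x + y \<in> int_localized p"
proof -
  obtain a b c d where "x = of_int a / of_int b" "\<not> int p dvd b" "y = of_int c / of_int d" "\<not> int p dvd d"
    using assms by (auto simp: int_localized_def)
  moreover from this have "b \<noteq> 0" "d \<noteq> 0" by auto
  ultimately have "x + y = of_int (a * d + c * b) / of_int (b * d)" "\<not> int p dvd b * d"
    using prime_int_p by (auto simp: field_simps prime_dvd_mult_iff)
  then show ?thesis using int_localizedI by metis
qed

lemma int_localized_mult:
  assumes "x \<in> int_localized p" "y \<in> int_localized p"
  shows "x * y \<in> int_localized p"
proof -
  obtain a b c d where "x = of_int a / of_int b" "\<not> int p dvd b" "y = of_int c / of_int d" "\<not> int p dvd d"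
    using assms by (auto simp: int_localized_def)
  moreover from this have "b \<noteq> 0" "d \<noteq> 0" by auto
  ultimately have "x * y = of_int (a * c) / of_int (b * d)" "\<not> int p dvd b * d"
    using prime_int_p by (auto simp: field_simps prime_dvd_mult_iff)
  then show ?thesis using int_localizedI by metis
qed

lemma int_localized_uminus: "x \<in> int_localized p \<Longrightarrow> - x \<in> int_localized p"
  using int_localized_mult[OF int_localized_of_int[of "- 1"], of x] by simp

lemma int_localized_diff: "x \<in> int_localized p \<Longrightarrow> y \<in> int_localized p \<Longrightarrow> x - y \<in> int_localized p"
  using int_localized_add[of x "- y"] int_localized_uminus by simp

lemma int_localized_inverse: "\<not> int p dvd b \<Longrightarrow> inverse (of_int b) \<in> int_localized p"
  using int_localizedI[of p b 1] by (simp add: field_simps)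

lemma cring_int_localized: "cring (int_localized_ring p)"
proof -
  interpret rat: field rat_field by (rule field_from_type_algebra)
  have "subring (int_localized p) rat_field"
    using int_localized_of_int[of 1]
    by (intro rat.subringI) (auto intro: int_localized_add int_localized_mult int_localized_uminus)
  then show ?thesis
    using rat.subcring_iff[of "int_localized p"] rat.subcringI'[of "int_localized p"] by simp
qed

text \<open>The additive inverse of a record is described relative to its carrier, so after
  restriction of the carrier it has to be computed anew.\<close>

lemma int_localized_a_minus:
  assumes "y \<in> int_localized p"
  shows "x \<ominus>\<^bsub>int_localized_ring p\<^esub> y = x - y"
proof -
  interpret cring "int_localized_ring p" by (rule cring_int_localized)
  have "\<ominus>\<^bsub>int_localized_ring p\<^esub> y = - y"
    using assms int_localized_uminus by (intro minus_equality) auto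
  then show ?thesis by (simp add: a_minus_def)
qed

lemma Units_int_localized: "Units (int_localized_ring p) = {x \<in> int_localized p. x \<noteq> 0 \<and> inverse x \<in> int_localized p}"
proof (intro equalityI subsetI)
  fix x assume "x \<in> Units (int_localized_ring p)"
  then obtain y where "x \<in> int_localized p" "y \<in> int_localized p" "x * y = 1"
    by (auto simp: Units_def)
  then show "x \<in> {x \<in> int_localized p. x \<noteq> 0 \<and> inverse x \<in> int_localized p}"
    using inverse_unique[of x y] by auto
next
  fix x assume "x \<in> {x \<in> int_localized p. x \<noteq> 0 \<and> inverse x \<in> int_localized p}"
  then show "x \<in> Units (int_localized_ring p)"
    unfolding Units_def by (auto intro!: bexI[of _ "inverse x"])
qed

text \<open>For \<open>k > 0\<close> the numerator \<open>b + p^k a\<close> is congruent to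
  \<open>b\<close> modulo \<open>p\<close>, hence still prime to \<open>p\<close>.\<close>

lemma int_localized_add_Units:
  assumes "x \<in> int_localized p" "k > 0"
  shows "1 + of_nat p ^ k * x \<in> Units (int_localized_ring p)"
proof -
  obtain a b where ab: "x = of_int a / of_int b" "\<not> int p dvd b"
    using assms by (auto simp: int_localized_def)
  define c where "c = b + int p ^ k * a"
  have "int p dvd int p ^ k * a" using assms(2) by (simp add: dvd_mult2)
  then have c: "\<not> int p dvd c"
    using ab(2) unfolding c_def by (simp add: dvd_add_left_iff)
  then have nz: "b \<noteq> 0" "c \<noteq> 0" using ab(2) by auto
  have "1 + of_nat p ^ k * x = of_int c / of_int b"
    using nz by (simp add: ab(1) c_def field_simps)
  moreover have "inverse (of_int c / of_int b) = (of_int b / of_int c :: rat)" by simp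
  ultimately show ?thesis
    using int_localizedI[OF ab(2), of c] int_localizedI[OF c, of b] nz by (simp add: Units_int_localized)
qed

end

section \<open>Complex roots, integrality and the power of \<open>p\<close> in the
  discriminant\<close>

lemma complex_roots:
  assumes "has_roots2 complex_field (of_int P) (of_int Q) \<theta>1 \<theta>2"
  shows "of_int P = \<theta>1 + \<theta>2" "of_int Q = \<theta>1 * \<theta>2"
proof -
  interpret field complex_field by (rule field_from_type_algebra)
  show "of_int P = \<theta>1 + \<theta>2" "of_int Q = \<theta>1 * \<theta>2"
    using assms by (simp_all add: has_roots2_iff)
qed

lemma lrec_roots_rat:
  assumes "Q \<noteq> 0" "has_roots2 complex_field (of_int P) (of_int Q) \<theta>1 \<theta>2"
  shows "lrec_roots rat_field (of_int P) (of_int Q) complex_field of_rat \<theta>1 \<theta>2"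
proof -
  interpret rat: field rat_field by (rule field_from_type_algebra)
  interpret com: field complex_field by (rule field_from_type_algebra)
  show ?thesis
    using assms(1) complex_roots[OF assms(2)]
    by unfold_locales (auto intro!: ring_hom_memI simp: inj_on_def of_rat_add of_rat_mult)
qed

lemma lrec_roots_localized:
  assumes p: "Factorial_Ring.prime p" and "\<not> int p dvd Q"
    and "has_roots2 complex_field (of_int P) (of_int Q) \<theta>1 \<theta>2"
  shows "lrec_roots (int_localized_ring p) (of_int P) (of_int Q) complex_field of_rat \<theta>1 \<theta>2"
proof -
  interpret loc: cring "int_localized_ring p" by (rule cring_int_localized[OF p])
  interpret com: field complex_field by (rule field_from_type_algebra)
  have "Q \<noteq> 0" using assms(2) by auto
  then show ?thesis
    using assms(2) complex_roots[OF assms(3)] int_localized_inverse[OF p, of Q]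
    by unfold_locales (auto intro!: ring_hom_memI simp: inj_on_def of_rat_add of_rat_mult p Units_int_localized)
qed

text \<open>In lowest terms \<open>r = a / b\<close>, clearing denominators gives
  \<open>a^2 = b (P a - Q b)\<close>; so \<open>b\<close> divides \<open>a^2\<close> while coprime
  to \<open>a\<close>. Integral roots make divisibility of their difference by powers of
  \<open>p\<close> meaningful.\<close>

lemma rational_root_of_monic_int:
  fixes r :: rat
  assumes "r * r - of_int P * r + of_int Q = 0"
  shows "\<exists>m. r = of_int m"
proof -
  obtain a b where q: "quotient_of r = (a, b)" by (cases "quotient_of r")
  have r: "r = of_int a / of_int b" "b > 0" "coprime a b"
    using q quotient_of_div quotient_of_denom_pos quotient_of_coprime by auto
  then have "of_int (a * a) = (of_int (b * (P * a - Q * b)) :: rat)"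
  proof -
    have rb: "r * of_int b = of_int a" using r(1,2) by simp
    have "of_int b * (of_int b * (r * r - of_int P * r + of_int Q)) = (0 :: rat)" using assms by simp
    then have "(r * of_int b) * (r * of_int b) = of_int b * (of_int P * (r * of_int b) - of_int Q * of_int b)"
      by (simp add: algebra_simps)
    then show ?thesis unfolding rb by simp
  qed
  then have "b dvd a * a" by (metis dvd_triv_left of_int_eq_iff)
  then have "b dvd 1"
    using r(3) by (metis coprime_commute coprime_dvd_mult_left_iff coprime_absorb_left coprime_mult_right_iff is_unit_left_imp_coprime)
  then have "b = 1" using r(2) by (simp add: zdvd1_eq)
  then show ?thesis using r(1) by auto
qed

lemma reducible_imp_int_roots:
  assumes "Q \<noteq> 0" and roots: "has_roots2 complex_field (of_int P) (of_int Q) \<theta>1 \<theta>2"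
    and red: "\<not> irreducible2 rat_field (of_int P) (of_int Q)"
  obtains t1 t2 :: int where "\<theta>1 = of_int t1" "\<theta>2 = of_int t2" "P = t1 + t2" "Q = t1 * t2"
proof -
  interpret lrec_roots rat_field "of_int P" "of_int Q" complex_field of_rat \<theta>1 \<theta>2
    by (rule lrec_roots_rat[OF assms(1,2)])
  interpret rat: field rat_field by (rule field_from_type_algebra)
  obtain r :: rat where "r * r - of_int P * r + of_int Q = 0"
    using red by (auto simp: rat.irreducible2_iff)
  then obtain r1 r2 :: rat where r: "of_rat r1 = \<theta>1" "of_rat r2 = \<theta>2"
    using root_imp_theta[of r] by auto
  have PQ: "of_int P = \<theta>1 + \<theta>2" "of_int Q = \<theta>1 * \<theta>2"
    using complex_roots[OF roots] by simp_all
  have "(of_rat (of_int P) :: complex) = of_rat (r1 + r2)" "(of_rat (of_int Q) :: complex) = of_rat (r1 * r2)"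
    using PQ r by (simp_all add: of_rat_add of_rat_mult)
  then have PQr: "of_int P = r1 + r2" "of_int Q = r1 * r2"
    by (simp_all only: of_rat_eq_iff)
  have "r1 * r1 - of_int P * r1 + of_int Q = 0" "r2 * r2 - of_int P * r2 + of_int Q = 0"
    by (simp_all add: PQr algebra_simps)
  then obtain t1 t2 where t: "r1 = of_int t1" "r2 = of_int t2"
    using rational_root_of_monic_int by metis
  have "of_int P = (of_int (t1 + t2) :: rat)" "of_int Q = (of_int (t1 * t2) :: rat)"
    using PQr t by simp_all
  then have "P = t1 + t2" "Q = t1 * t2"
    by (simp_all only: of_int_eq_iff)
  moreover have "\<theta>1 = of_int t1" "\<theta>2 = of_int t2"
    using r t by auto
  ultimately show ?thesis using that by blast
qed

text \<open>The exact power of \<open>p\<close> in a square has even exponent. Applied to the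
  difference of the integral roots, it shows that this difference is exactly divisible by
  \<open>p^(s/2)\<close>.\<close>

lemma square_eq_prime_power_mult:
  assumes p: "Factorial_Ring.prime p" and d: "d\<^sup>2 = int p ^ s * D" "\<not> int p dvd D" "d \<noteq> 0"
  obtains c where "even s" "d = int p ^ (s div 2) * c" "\<not> int p dvd c"
proof -
  have pp: "Factorial_Ring.prime (int p)" using p by simp
  then have "int p \<noteq> 0" "\<not> is_unit (int p)" by auto
  then obtain c where c: "d = int p ^ multiplicity (int p) d * c" "\<not> int p dvd c"
    using multiplicity_decompose'[of d "int p"] d(3) by metis
  define k where "k = multiplicity (int p) d"
  have eq: "int p ^ s * D = int p ^ (2 * k) * c\<^sup>2"
    using d(1) c(1) unfolding k_def[symmetric] by (metis power_mult_distrib power_mult mult.commute)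
  have c2: "\<not> int p dvd c\<^sup>2" using c(2) pp by (simp add: prime_dvd_power_iff)
  have "s = 2 * k"
  proof (rule ccontr)
    assume "s \<noteq> 2 * k"
    then consider "s < 2 * k" | "2 * k < s" by linarith
    then show False
    proof cases
      case 1
      \<comment> \<open>The surplus is written as a successor so that one factor \<open>p\<close>
        splits off and contradicts that \<open>p\<close> does not divide the cofactor.\<close>
      then have "2 * k = s + Suc (2 * k - s - 1)" by simp
      then have "int p ^ (2 * k) = int p ^ s * (int p * int p ^ (2 * k - s - 1))"
        by (metis power_add power_Suc)
      then have "D = int p * int p ^ (2 * k - s - 1) * c\<^sup>2"
        using eq \<open>int p \<noteq> 0\<close> by (simp add: mult.assoc)
      then show False using d(2) by simp
    next
      case 2
      then have "s = 2 * k + Suc (s - 2 * k - 1)" by simp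
      then have "int p ^ s = int p ^ (2 * k) * (int p * int p ^ (s - 2 * k - 1))"
        by (metis power_add power_Suc)
      then have "c\<^sup>2 = int p * int p ^ (s - 2 * k - 1) * D"
        using eq \<open>int p \<noteq> 0\<close> by (simp add: mult.assoc)
      then show False using c2 by simp
    qed
  qed
  then show ?thesis using that[of c] c unfolding k_def[symmetric] by simp
qed

section \<open>The field with \<open>p\<close> elements\<close>

context
  fixes p :: nat
  assumes p: "Factorial_Ring.prime p"
begin

interpretation residues_prime p "prime_field p"
  by unfold_locales (rule p)

lemma prime_field_unit: "\<not> int p dvd x \<Longrightarrow> x mod int p \<in> Units (prime_field p)"
  using mod_in_res_units[OF m_gt_one, of x] p_coprime_right_int[of x] by blast

lemma prime_field_nonzero_unit: "x \<in> carrier (prime_field p) \<Longrightarrow> x \<noteq> \<zero>\<^bsub>prime_field p\<^esub> \<Longrightarrow> x \<in> Units (prime_field p)"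
  using field.field_Units[OF is_field] by auto

lemma prime_field_poly:
  "r \<otimes>\<^bsub>prime_field p\<^esub> r \<ominus>\<^bsub>prime_field p\<^esub> (P mod int p) \<otimes>\<^bsub>prime_field p\<^esub> r \<oplus>\<^bsub>prime_field p\<^esub> (Q mod int p)
    = (r * r - P * r + Q) mod int p"
  by (simp add: a_minus_def res_add_eq res_mult_eq res_neg_eq mod_simps)

lemma lrec_prime_field:
  assumes "\<not> int p dvd Q"
  shows "lrec (prime_field p) (P mod int p) (Q mod int p)"
  using prime_field_unit[OF assms] by unfold_locales auto

text \<open>A homomorphism between fields is injective, so every field \<open>L\<close> that
  receives the residue field and contains the roots fits the general setting.\<close>

lemma lrec_roots_prime_field:
  assumes "\<not> int p dvd Q" and L: "field L" and h: "h \<in> ring_hom (prime_field p) L"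
    and roots: "has_roots2 L (h (P mod int p)) (h (Q mod int p)) \<eta>1 \<eta>2"
  shows "lrec_roots (prime_field p) (P mod int p) (Q mod int p) L h \<eta>1 \<eta>2"
proof -
  interpret lrec "prime_field p" "P mod int p" "Q mod int p" by (rule lrec_prime_field[OF assms(1)])
  interpret L: field L by (rule L)
  interpret h: ring_hom_ring "prime_field p" L h
    using h by (intro ring_hom_ringI2 ring_axioms L.ring_axioms)
  have "inj_on h (carrier (prime_field p))"
    by (rule non_trivial_field_hom_is_inj[OF h is_field L])
  then show ?thesis
    using h roots L.has_roots2_iff[of "h (P mod int p)" "h (Q mod int p)" \<eta>1 \<eta>2]
    by unfold_locales auto
qed

end

section \<open>Double roots\<close>

context lrec begin

text \<open>With a double root \<open>r\<close>, write a unit as \<open>e\<close> times \<open>(\<one> \<oplus> x \<otimes> r, x)\<close>. Multiplication by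
  \<open>t\<close> then amounts to \<open>x \<mapsto> x \<oplus> inv r\<close>.\<close>

lemma Units_quad_subset_S:
  assumes r: "r \<in> Units R" and P: "P = r \<oplus> r" and Q: "Q = r \<otimes> r"
    and cyclic: "\<And>x. x \<in> carrier R \<Longrightarrow> \<exists>n::nat. x = ((\<lambda>y. y \<oplus> inv r) ^^ n) \<zero>"
  shows "Units quad \<subseteq> S"
proof
  have rc: "r \<in> carrier R" using r by (rule Units_closed)
  define i where "i = inv r"
  have i: "i \<in> Units R" "i \<in> carrier R" "i \<otimes> r = \<one>" using r by (simp_all add: i_def)
  have scalar_S: "(c, \<zero>) \<in> S" if "c \<in> Units R" for c
  proof -
    have "(c, \<zero>) \<otimes>\<^bsub>quad\<^esub> tpow 0 \<in> S" using that unfolding S_alt by blast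
    moreover have "(c, \<zero>) \<otimes>\<^bsub>quad\<^esub> \<one>\<^bsub>quad\<^esub> = (c, \<zero>)" using that by (intro quad.r_one) (simp add: Units_closed)
    ultimately show ?thesis by (simp add: tpow_0 del: int_pow_0)
  qed
  have t_S: "t \<in> S"
  proof -
    have "(\<one>, \<zero>) \<otimes>\<^bsub>quad\<^esub> tpow 1 \<in> S" unfolding S_alt by blast
    moreover have "\<one>\<^bsub>quad\<^esub> \<otimes>\<^bsub>quad\<^esub> t = t" using t_unit by (intro quad.l_one quad.Units_closed)
    ultimately show ?thesis by (simp add: tpow_1 del: U.int_pow_1)
  qed
  have S_mult: "x \<otimes>\<^bsub>quad\<^esub> y \<in> S" if "x \<in> S" "y \<in> S" for x y
    using subgroup.m_closed[OF S_subgroup that] by simp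
  have scale: "(c, \<zero>) \<otimes>\<^bsub>quad\<^esub> (a, b) = (c \<otimes> a, c \<otimes> b)" if "a \<in> carrier R" "b \<in> carrier R" "c \<in> carrier R" for a b c
    using that by (simp add: mult_quad minus_eq)
  have step: "(\<one> \<oplus> (x \<oplus> i) \<otimes> r, x \<oplus> i) \<in> S" if x: "x \<in> carrier R" "(\<one> \<oplus> x \<otimes> r, x) \<in> S" for x
  proof -
    \<comment> \<open>The product with \<open>t\<close> has value \<open>r\<close> at the double
      root; the scalar \<open>i = inv r\<close> restores the normalization to value
      \<open>1\<close>.\<close>
    have "(i, \<zero>) \<otimes>\<^bsub>quad\<^esub> ((\<one> \<oplus> x \<otimes> r, x) \<otimes>\<^bsub>quad\<^esub> t) \<in> S"
      using S_mult scalar_S[OF i(1)] t_S x(2) by blast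
    also have "(\<one> \<oplus> x \<otimes> r, x) \<otimes>\<^bsub>quad\<^esub> t = (P \<otimes> (\<one> \<oplus> x \<otimes> r) \<ominus> Q \<otimes> x, \<one> \<oplus> x \<otimes> r)"
      using x(1) rc by (simp add: mult_t)
    also have "(i, \<zero>) \<otimes>\<^bsub>quad\<^esub> \<dots> = (i \<otimes> (P \<otimes> (\<one> \<oplus> x \<otimes> r) \<ominus> Q \<otimes> x), i \<otimes> (\<one> \<oplus> x \<otimes> r))"
      using x(1) rc i(2) by (intro scale) simp_all
    also have "i \<otimes> (P \<otimes> (\<one> \<oplus> x \<otimes> r) \<ominus> Q \<otimes> x) = (i \<otimes> r) \<otimes> (\<one> \<oplus> \<one> \<oplus> x \<otimes> r)"
      unfolding P Q using x(1) rc i(2) by algebra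
    also have "\<dots> = \<one> \<oplus> x \<otimes> r \<oplus> i \<otimes> r"
      unfolding i(3) using x(1) rc by algebra
    also have "\<dots> = \<one> \<oplus> (x \<oplus> i) \<otimes> r"
      using x(1) rc i(2) by algebra
    also have "i \<otimes> (\<one> \<oplus> x \<otimes> r) = i \<oplus> (i \<otimes> r) \<otimes> x"
      using x(1) rc i(2) by algebra
    also have "\<dots> = x \<oplus> i"
      using x(1) i(2) by (simp add: i(3) a_comm)
    finally show ?thesis .
  qed
  have iter: "((\<lambda>y. y \<oplus> i) ^^ n) \<zero> \<in> carrier R \<and>
    (\<one> \<oplus> ((\<lambda>y. y \<oplus> i) ^^ n) \<zero> \<otimes> r, ((\<lambda>y. y \<oplus> i) ^^ n) \<zero>) \<in> S" for n
  proof (induction n)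
    case 0
    then show ?case using scalar_S[of \<one>] rc by simp
  next
    case (Suc n)
    then show ?case using step i(2) by simp
  qed
  fix w assume w: "w \<in> Units quad"
  obtain a b where ab: "w = (a, b)" by (cases w)
  have cl: "a \<in> carrier R" "b \<in> carrier R" "nrm a b \<in> Units R"
    using w ab by (auto simp: Units_quad)
  \<comment> \<open>The value at the double root. The norm is its square, so \<open>e\<close> is a
    unit and can be divided out to reach the normalized form.\<close>
  define e where "e = a \<ominus> b \<otimes> r"
  have ec: "e \<in> carrier R" using cl rc by (simp add: e_def)
  have "nrm a b = e \<otimes> e"
    unfolding nrm_eq_mult[OF cl(1,2)] unfolding e_def P Q using cl(1,2) rc by algebra
  then have e: "e \<in> Units R" using cl(3) ec by (metis unit_factor)
  define x where "x = inv e \<otimes> b"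
  have x: "x \<in> carrier R" "e \<otimes> x = b"
    using e ec cl(2) by (simp_all add: x_def flip: m_assoc)
  obtain n where "x = ((\<lambda>y. y \<oplus> i) ^^ n) \<zero>"
    using cyclic[OF x(1)] unfolding i_def by blast
  then have "(\<one> \<oplus> x \<otimes> r, x) \<in> S" using iter[of n] by simp
  then have "(e, \<zero>) \<otimes>\<^bsub>quad\<^esub> (\<one> \<oplus> x \<otimes> r, x) \<in> S"
    using S_mult scalar_S[OF e] by blast
  also have "(e, \<zero>) \<otimes>\<^bsub>quad\<^esub> (\<one> \<oplus> x \<otimes> r, x) = (e \<otimes> (\<one> \<oplus> x \<otimes> r), e \<otimes> x)"
    using x(1) rc ec by (intro scale) simp_all
  also have "e \<otimes> (\<one> \<oplus> x \<otimes> r) = e \<oplus> (e \<otimes> x) \<otimes> r"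
    using x(1) rc ec by algebra
  also have "\<dots> = e \<oplus> b \<otimes> r"
    by (simp add: x(2))
  also have "\<dots> = a"
    unfolding e_def using cl(1,2) rc by algebra
  finally show "w \<in> S" by (simp add: ab x(2))
qed

end

section \<open>The isomorphisms over the prime field\<close>

context
  fixes p :: nat and P Q :: int
  assumes p: "Factorial_Ring.prime p" and pQ: "\<not> int p dvd Q"
begin

interpretation residues_prime p "prime_field p"
  by unfold_locales (rule p)

lemma irreducible2_prime_field:
  "irreducible2 (prime_field p) (P mod int p) (Q mod int p) \<longleftrightarrow>
    (\<forall>r \<in> {0..int p - 1}. \<not> int p dvd r * r - P * r + Q)"
  unfolding field.irreducible2_iff[OF is_field mod_in_carrier mod_in_carrier] prime_field_poly[OF p]
  by (simp add: res_carrier_eq res_zero_eq dvd_eq_mod_eq_0)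

lemma trivial_Gstar_prime_field:
  assumes red: "\<not> irreducible2 (prime_field p) (P mod int p) (Q mod int p)"
    and D: "int p dvd P\<^sup>2 - 4 * Q"
  shows "trivial_group (Gstar (prime_field p) (P mod int p) (Q mod int p))"
proof -
  interpret lrec "prime_field p" "P mod int p" "Q mod int p"
    by (rule lrec_prime_field[OF p pQ])
  have pp: "Factorial_Ring.prime (int p)" using p by simp
  obtain r where r: "r \<in> {0..int p - 1}" "int p dvd r * r - P * r + Q"
    using red by (auto simp: irreducible2_prime_field)
  \<comment> \<open>A root modulo \<open>p\<close> together with \<open>p\<close> dividing
    \<open>D\<close> gives \<open>P = 2 r\<close> modulo \<open>p\<close>. Nothing is divided by
    \<open>2\<close> or \<open>4\<close>, so \<open>p = 2\<close> is included.\<close>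
  have "(2 * r - P)\<^sup>2 = 4 * (r * r - P * r + Q) + (P\<^sup>2 - 4 * Q)"
    by Groebner_Basis.algebra
  then have "int p dvd (2 * r - P)\<^sup>2" using r(2) D by (metis dvd_add dvd_mult)
  then have d: "int p dvd 2 * r - P" using pp by (simp add: prime_dvd_power_iff)
  then have P: "P mod int p = (r + r) mod int p"
    by (metis mod_eq_dvd_iff mult_2)
  have "r * r - Q = (2 * r - P) * r - (r * r - P * r + Q)"
    by (simp add: algebra_simps)
  then have "int p dvd r * r - Q" using d r(2) by (metis dvd_diff dvd_mult2)
  then have Q: "Q mod int p = (r * r) mod int p"
    by (metis mod_eq_dvd_iff)
  have pr: "\<not> int p dvd r"
    using Q pQ by (metis dvd_eq_mod_eq_0 dvd_mult2)
  have r_mod: "r mod int p = r" using r(1) by simp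
  have ru: "r \<in> Units (prime_field p)"
    using prime_field_unit[OF p pr] by (simp add: r_mod)
  define i where "i = inv\<^bsub>prime_field p\<^esub> r"
  have ir: "(i * r) mod int p = 1"
    using Units_l_inv[OF ru] by (simp add: i_def res_mult_eq res_one_eq)
  have iter: "((\<lambda>y. y \<oplus>\<^bsub>prime_field p\<^esub> i) ^^ n) \<zero>\<^bsub>prime_field p\<^esub> = (int n * i) mod int p" for n
  proof (induction n)
    case (Suc n)
    have "((\<lambda>y. y \<oplus>\<^bsub>prime_field p\<^esub> i) ^^ Suc n) \<zero>\<^bsub>prime_field p\<^esub> = ((int n * i) mod int p + i) mod int p"
      using Suc by (simp add: res_add_eq)
    also have "\<dots> = (int (Suc n) * i) mod int p"
      by (simp add: mod_simps algebra_simps)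
    finally show ?case .
  qed (simp add: res_zero_eq)
  have "Units quad \<subseteq> S"
  proof (rule Units_quad_subset_S[OF ru])
    show "P mod int p = r \<oplus>\<^bsub>prime_field p\<^esub> r" "Q mod int p = r \<otimes>\<^bsub>prime_field p\<^esub> r"
      using P Q by (simp_all add: res_add_eq res_mult_eq)
    fix x assume x: "x \<in> carrier (prime_field p)"
    \<comment> \<open>The number of shifts solves \<open>n i = x\<close> modulo \<open>p\<close>,
      where \<open>i\<close> is the inverse of \<open>r\<close>: take
      \<open>n = x r\<close>.\<close>
    define n where "n = nat (x * r mod int p)"
    have "int n = x * r mod int p" using prime_gt_0_nat[OF p] by (simp add: n_def)
    then have "(int n * i) mod int p = (x * (i * r mod int p)) mod int p"
      by (simp add: mod_simps ac_simps)
    also have "\<dots> = x" using x ir by (simp add: res_carrier_eq)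
    finally have "x = ((\<lambda>y. y \<oplus>\<^bsub>prime_field p\<^esub> i) ^^ n) \<zero>\<^bsub>prime_field p\<^esub>"
      unfolding iter by simp
    then show "\<exists>n. x = ((\<lambda>y. y \<oplus>\<^bsub>prime_field p\<^esub> inv\<^bsub>prime_field p\<^esub> r) ^^ n) \<zero>\<^bsub>prime_field p\<^esub>"
      unfolding i_def by blast
  qed
  then show ?thesis by (rule trivial_Gstar)
qed

lemma prime_field_irreducible_iso:
  fixes L :: "'l ring"
  assumes L: "field L" and h: "h \<in> ring_hom (prime_field p) L"
    and roots: "has_roots2 L (h (P mod int p)) (h (Q mod int p)) \<eta>1 \<eta>2"
    and irr: "irreducible2 (prime_field p) (P mod int p) (Q mod int p)"
    and M: "M = units_in L (generate_field L (insert \<eta>1 (h ` carrier (prime_field p))))"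
  shows "Gstar_iso_via (prime_field p) (P mod int p) (Q mod int p) M
    (times_cyclic M (h ` Units (prime_field p)) \<eta>1) (\<lambda>w1 w0. h w1 \<ominus>\<^bsub>L\<^esub> h w0 \<otimes>\<^bsub>L\<^esub> \<eta>1)"
proof -
  interpret lrec_roots "prime_field p" "P mod int p" "Q mod int p" L h \<eta>1 \<eta>2
    by (rule lrec_roots_prime_field[OF p pQ L h roots])
  have indep: "b = \<zero>\<^bsub>prime_field p\<^esub>" if "a \<in> carrier (prime_field p)" "b \<in> carrier (prime_field p)"
    "h a = h b \<otimes>\<^bsub>L\<^esub> \<eta>1" for a b
    using no_root_imp_indep[OF prime_field_nonzero_unit[OF p] _ that] irr
    by (simp add: field.irreducible2_iff[OF is_field mod_in_carrier mod_in_carrier])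
  have "M = units_of (L\<lparr>carrier := ext\<rparr>)"
    unfolding M using generate_field_eq[OF indep prime_field_nonzero_unit[OF p]] by simp
  from Gstar_iso_via_ext[OF indep this] show ?thesis .
qed

lemma prime_field_split_iso:
  fixes L :: "'l ring"
  assumes L: "field L" and h: "h \<in> ring_hom (prime_field p) L"
    and roots: "has_roots2 L (h (P mod int p)) (h (Q mod int p)) \<eta>1 \<eta>2"
    and red: "\<not> irreducible2 (prime_field p) (P mod int p) (Q mod int p)" and D: "\<not> int p dvd P\<^sup>2 - 4 * Q"
    and M: "M = units_in L (h ` carrier (prime_field p))"
  shows "Gstar_iso_via (prime_field p) (P mod int p) (Q mod int p) M (generate M {\<eta>1 \<otimes>\<^bsub>L\<^esub> inv\<^bsub>L\<^esub> \<eta>2})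
    (\<lambda>w1 w0. (h w1 \<ominus>\<^bsub>L\<^esub> h w0 \<otimes>\<^bsub>L\<^esub> \<eta>1) \<otimes>\<^bsub>L\<^esub> inv\<^bsub>L\<^esub> (h w1 \<ominus>\<^bsub>L\<^esub> h w0 \<otimes>\<^bsub>L\<^esub> \<eta>2))"
proof -
  interpret lrec_roots "prime_field p" "P mod int p" "Q mod int p" L h \<eta>1 \<eta>2
    by (rule lrec_roots_prime_field[OF p pQ L h roots])
  obtain r where "r \<in> carrier (prime_field p)" "r \<otimes>\<^bsub>prime_field p\<^esub> r \<ominus>\<^bsub>prime_field p\<^esub> (P mod int p) \<otimes>\<^bsub>prime_field p\<^esub> r
      \<oplus>\<^bsub>prime_field p\<^esub> (Q mod int p) = \<zero>\<^bsub>prime_field p\<^esub>"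
    using red by (auto simp: field.irreducible2_iff[OF is_field mod_in_carrier mod_in_carrier])
  then obtain r1 r2 where r: "r1 \<in> carrier (prime_field p)" "r2 \<in> carrier (prime_field p)" "h r1 = \<eta>1" "h r2 = \<eta>2"
    using root_imp_theta by blast
  have "h (P mod int p) = h (r1 \<oplus>\<^bsub>prime_field p\<^esub> r2)" "h (Q mod int p) = h (r1 \<otimes>\<^bsub>prime_field p\<^esub> r2)"
    using r by (simp_all add: h_P h_Q)
  then have PQ: "P mod int p = (r1 + r2) mod int p" "Q mod int p = (r1 * r2) mod int p"
    using r by (simp_all add: h_eq_iff res_add_eq res_mult_eq)
  \<comment> \<open>A common value \<open>r\<close> would give \<open>P = 2 r\<close> and
    \<open>Q = r^2\<close> modulo \<open>p\<close>, so \<open>D\<close> would vanish modulo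
    \<open>p\<close>.\<close>
  have "r1 \<noteq> r2"
  proof
    assume "r1 = r2"
    then have "int p dvd P - (r1 + r1)" "int p dvd Q - r1 * r1"
      using PQ by (simp_all add: mod_eq_dvd_iff)
    moreover have "P\<^sup>2 - 4 * Q = (P - (r1 + r1)) * (P + (r1 + r1)) - 4 * (Q - r1 * r1)"
      by Groebner_Basis.algebra
    ultimately show False using D by (metis dvd_diff dvd_mult dvd_mult2)
  qed
  then have "r1 \<ominus>\<^bsub>prime_field p\<^esub> r2 \<in> Units (prime_field p)"
    using r by (intro prime_field_nonzero_unit[OF p]) simp_all
  then show ?thesis
    by (rule Gstar_iso_via_split[OF r _ M])
qed

end

section \<open>The isomorphisms over the rationals and the local ring\<close>

text \<open>Serves the local ring as well: \<open>no_root_imp_indep\<close> asks for a field, so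
  independence is obtained over the rationals and then restricted.\<close>

lemma rat_indep:
  fixes a b :: rat
  assumes "Q \<noteq> 0" and "has_roots2 complex_field (of_int P) (of_int Q) \<theta>1 \<theta>2"
    and irr: "irreducible2 rat_field (of_int P) (of_int Q)"
    and eq: "of_rat a = of_rat b * \<theta>1"
  shows "b = 0"
proof -
  interpret lrec_roots rat_field "of_int P" "of_int Q" complex_field of_rat \<theta>1 \<theta>2
    by (rule lrec_roots_rat[OF assms(1,2)])
  interpret rat: field rat_field by (rule field_from_type_algebra)
  show ?thesis
    using no_root_imp_indep[of a b] irr eq by (simp add: rat.irreducible2_iff)
qed

lemma rat_irreducible_iso:
  assumes "Q \<noteq> 0" and "has_roots2 complex_field (of_int P) (of_int Q) \<theta>1 \<theta>2"
    and irr: "irreducible2 rat_field (of_int P) (of_int Q)"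
    and M: "M = units_in complex_field (generate_field complex_field (insert \<theta>1 (of_rat ` carrier rat_field)))"
  shows "Gstar_iso_via rat_field (of_int P) (of_int Q) M (times_cyclic M (of_rat ` Units rat_field) \<theta>1)
    (\<lambda>w1 w0. of_rat w1 - of_rat w0 * \<theta>1)"
proof -
  interpret lrec_roots rat_field "of_int P" "of_int Q" complex_field of_rat \<theta>1 \<theta>2
    by (rule lrec_roots_rat[OF assms(1,2)])
  have indep: "b = \<zero>\<^bsub>rat_field\<^esub>" if "a \<in> carrier rat_field" "b \<in> carrier rat_field"
    "of_rat a = of_rat b \<otimes>\<^bsub>complex_field\<^esub> \<theta>1" for a b
    using rat_indep[OF assms(1,2) irr, of a b] that by simp
  have "generate_field complex_field (insert \<theta>1 (of_rat ` carrier rat_field)) = ext"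
    by (rule generate_field_eq[OF indep]) simp_all
  then have "M = units_of (complex_field\<lparr>carrier := ext\<rparr>)"
    by (simp add: M)
  from Gstar_iso_via_ext[OF indep this] show ?thesis by simp
qed

lemma localized_irreducible_iso:
  assumes p: "Factorial_Ring.prime p" "\<not> int p dvd Q"
    and roots: "has_roots2 complex_field (of_int P) (of_int Q) \<theta>1 \<theta>2"
    and irr: "irreducible2 rat_field (of_int P) (of_int Q)"
    and M: "M = units_in complex_field (generate_ring complex_field (insert \<theta>1 (of_rat ` int_localized p)))"
  shows "Gstar_iso_via (int_localized_ring p) (of_int P) (of_int Q) M
    (times_cyclic M (of_rat ` Units (int_localized_ring p)) \<theta>1) (\<lambda>w1 w0. of_rat w1 - of_rat w0 * \<theta>1)"
proof -
  interpret lrec_roots "int_localized_ring p" "of_int P" "of_int Q" complex_field of_rat \<theta>1 \<theta>2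
    by (rule lrec_roots_localized[OF p roots])
  have "Q \<noteq> 0" using p(2) by auto
  then have indep: "b = \<zero>\<^bsub>int_localized_ring p\<^esub>"
    if "a \<in> carrier (int_localized_ring p)" "b \<in> carrier (int_localized_ring p)"
      "of_rat a = of_rat b \<otimes>\<^bsub>complex_field\<^esub> \<theta>1" for a b
    using rat_indep[OF _ roots irr, of a b] that by simp
  have "M = units_of (complex_field\<lparr>carrier := ext\<rparr>)"
    using generate_ring_eq by (simp add: M)
  from Gstar_iso_via_ext[OF indep this] show ?thesis by simp
qed

context
  fixes R :: "rat ring" and P Q :: int and \<theta>1 \<theta>2 :: complex
  assumes "lrec_roots R (of_int P) (of_int Q) complex_field of_rat \<theta>1 \<theta>2"
begin

interpretation lrec_roots R "of_int P" "of_int Q" complex_field of_rat \<theta>1 \<theta>2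
  by fact

lemma ratio_eq:
  assumes "w1 \<in> carrier R" "w0 \<in> carrier R" "lrec_norm R (of_int P) (of_int Q) w1 w0 \<in> Units R"
  shows "ratio w1 w0 = (of_rat w1 - of_rat w0 * \<theta>1) * inverse (of_rat w1 - of_rat w0 * \<theta>2)"
proof -
  \<comment> \<open>With the roots exchanged, \<open>lin_unit\<close> says that the denominator is a
    unit of the complex field.\<close>
  interpret swap: lrec_roots R "of_int P" "of_int Q" complex_field of_rat \<theta>2 \<theta>1
    by (rule lrec_roots_swap)
  have "(w1, w0) \<in> Units quad" using assms by (simp add: Units_quad)
  from swap.lin_unit[OF this] have "of_rat w1 - of_rat w0 * \<theta>2 \<noteq> 0" by (simp add: lin_def)
  then show ?thesis by simp
qed

lemma Gstar_iso_via_ratio_complex: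
  assumes "\<theta>2 \<noteq> 0"
  shows "Gstar_iso_via R (of_int P) (of_int Q) M (generate M {\<theta>1 \<otimes>\<^bsub>complex_field\<^esub> inv\<^bsub>complex_field\<^esub> \<theta>2}) ratio \<longleftrightarrow>
    Gstar_iso_via R (of_int P) (of_int Q) M (generate M {\<theta>1 * inverse \<theta>2})
      (\<lambda>w1 w0. (of_rat w1 - of_rat w0 * \<theta>1) * inverse (of_rat w1 - of_rat w0 * \<theta>2))"
  using assms Gstar_iso_via_cong[OF ratio_eq] by simp

end

lemma rat_split_iso:
  assumes "Q \<noteq> 0" "P\<^sup>2 - 4 * Q \<noteq> 0" and roots: "has_roots2 complex_field (of_int P) (of_int Q) \<theta>1 \<theta>2"
    and red: "\<not> irreducible2 rat_field (of_int P) (of_int Q)"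
    and M: "M = units_in complex_field (of_rat ` carrier rat_field)"
  shows "Gstar_iso_via rat_field (of_int P) (of_int Q) M (generate M {\<theta>1 * inverse \<theta>2})
    (\<lambda>w1 w0. (of_rat w1 - of_rat w0 * \<theta>1) * inverse (of_rat w1 - of_rat w0 * \<theta>2))"
proof -
  obtain t1 t2 where t: "\<theta>1 = of_int t1" "\<theta>2 = of_int t2" "P = t1 + t2" "Q = t1 * t2"
    using reducible_imp_int_roots[OF assms(1) roots red] by blast
  have lr: "lrec_roots rat_field (of_int P) (of_int Q) complex_field of_rat \<theta>1 \<theta>2"
    by (rule lrec_roots_rat[OF assms(1) roots])
  interpret lrec_roots rat_field "of_int P" "of_int Q" complex_field of_rat \<theta>1 \<theta>2
    by (rule lr)
  have "P\<^sup>2 - 4 * Q = (t1 - t2) * (t1 - t2)" unfolding t(3,4) by Groebner_Basis.algebra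
  then have "t1 \<noteq> t2" using assms(2) by auto
  then have "Gstar_iso_via rat_field (of_int P) (of_int Q) M
    (generate M {\<theta>1 \<otimes>\<^bsub>complex_field\<^esub> inv\<^bsub>complex_field\<^esub> \<theta>2}) ratio"
    using t(1,2) by (intro Gstar_iso_via_split[OF _ _ _ _ _ M, of "of_int t1" "of_int t2"]) simp_all
  moreover have "\<theta>2 \<noteq> 0" using t assms(1) by auto
  ultimately show ?thesis
    by (subst (asm) Gstar_iso_via_ratio_complex[OF lr]) auto
qed

lemma localized_split_iso:
  assumes p: "Factorial_Ring.prime p" "\<not> int p dvd Q" and D: "\<not> int p dvd P\<^sup>2 - 4 * Q"
    and roots: "has_roots2 complex_field (of_int P) (of_int Q) \<theta>1 \<theta>2"
    and red: "\<not> irreducible2 rat_field (of_int P) (of_int Q)"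
    and M: "M = units_in complex_field (of_rat ` int_localized p)"
  shows "Gstar_iso_via (int_localized_ring p) (of_int P) (of_int Q) M (generate M {\<theta>1 * inverse \<theta>2})
    (\<lambda>w1 w0. (of_rat w1 - of_rat w0 * \<theta>1) * inverse (of_rat w1 - of_rat w0 * \<theta>2))"
proof -
  have Q0: "Q \<noteq> 0" using p(2) by auto
  obtain t1 t2 where t: "\<theta>1 = of_int t1" "\<theta>2 = of_int t2" "P = t1 + t2" "Q = t1 * t2"
    using reducible_imp_int_roots[OF Q0 roots red] by blast
  have lr: "lrec_roots (int_localized_ring p) (of_int P) (of_int Q) complex_field of_rat \<theta>1 \<theta>2"
    by (rule lrec_roots_localized[OF p roots])
  interpret lrec_roots "int_localized_ring p" "of_int P" "of_int Q" complex_field of_rat \<theta>1 \<theta>2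
    by (rule lr)
  have "P\<^sup>2 - 4 * Q = (t1 - t2) * (t1 - t2)" unfolding t(3,4) by Groebner_Basis.algebra
  \<comment> \<open>Distinct roots are not enough here: their difference has to be invertible in the
    local ring. Its square is \<open>D\<close>, which is prime to \<open>p\<close>.\<close>
  then have d: "\<not> int p dvd t1 - t2" using D by auto
  have "of_int t1 \<ominus>\<^bsub>int_localized_ring p\<^esub> of_int t2 = (of_int (t1 - t2) :: rat)"
    by (simp add: int_localized_a_minus[OF p(1)] int_localized_of_int[OF p(1)])
  also have "\<dots> \<in> Units (int_localized_ring p)"
    using int_localized_inverse[OF p(1) d] int_localized_of_int[OF p(1), of "t1 - t2"] d
    unfolding Units_int_localized[OF p(1)] by auto
  finally have u: "of_int t1 \<ominus>\<^bsub>int_localized_ring p\<^esub> of_int t2 \<in> Units (int_localized_ring p)" .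
  have M': "M = units_of (complex_field\<lparr>carrier := of_rat ` carrier (int_localized_ring p)\<rparr>)"
    by (simp add: M)
  have "Gstar_iso_via (int_localized_ring p) (of_int P) (of_int Q) M
    (generate M {\<theta>1 \<otimes>\<^bsub>complex_field\<^esub> inv\<^bsub>complex_field\<^esub> \<theta>2}) ratio"
    using t(1,2) int_localized_of_int[OF p(1)] by (intro Gstar_iso_via_split[OF _ _ _ _ u M']) simp_all
  moreover have "\<theta>2 \<noteq> 0" using t Q0 by auto
  ultimately show ?thesis
    by (subst (asm) Gstar_iso_via_ratio_complex[OF lr]) auto
qed

text \<open>With \<open>k = s div 2\<close> and \<open>t1 - t2 = p^k c\<close>, \<open>c\<close>
  prime to \<open>p\<close>, the quotient for \<open>(a, b)\<close> is
  \<open>1 - p^k b c / (a - b t2)\<close>. This puts the image inside \<open>1 + p^k\<close> times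
  the local ring. Every such element occurs already with \<open>a - b t2 = 1\<close>, since
  \<open>c\<close> can be inverted.\<close>

lemma localized_ramified_iso:
  assumes p: "Factorial_Ring.prime p" "\<not> int p dvd Q" and D0: "P\<^sup>2 - 4 * Q \<noteq> 0"
    and s: "P\<^sup>2 - 4 * Q = int p ^ s * D\<^sub>0" "\<not> int p dvd D\<^sub>0"
    and D: "int p dvd P\<^sup>2 - 4 * Q"
    and roots: "has_roots2 complex_field (of_int P) (of_int Q) \<theta>1 \<theta>2"
    and red: "\<not> irreducible2 rat_field (of_int P) (of_int Q)"
    and M: "M = (units_of complex_field)\<lparr>carrier := {1 + of_nat p ^ (s div 2) * of_rat x | x. x \<in> int_localized p}\<rparr>"
  shows "even s" and "Gstar_iso_via (int_localized_ring p) (of_int P) (of_int Q) M (generate M {\<theta>1 * inverse \<theta>2})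
    (\<lambda>w1 w0. (of_rat w1 - of_rat w0 * \<theta>1) * inverse (of_rat w1 - of_rat w0 * \<theta>2))"
proof -
  have Q0: "Q \<noteq> 0" using p(2) by auto
  obtain t1 t2 where t: "\<theta>1 = of_int t1" "\<theta>2 = of_int t2" "P = t1 + t2" "Q = t1 * t2"
    using reducible_imp_int_roots[OF Q0 roots red] by blast
  have Dt: "(t1 - t2)\<^sup>2 = int p ^ s * D\<^sub>0"
    unfolding s(1)[symmetric] using t by (simp add: power2_eq_square algebra_simps)
  have tne: "t1 - t2 \<noteq> 0" using D0 s(1) Dt by auto
  obtain c where c: "even s" "t1 - t2 = int p ^ (s div 2) * c" "\<not> int p dvd c"
    by (rule square_eq_prime_power_mult[OF p(1) Dt s(2) tne])
  show "even s" by fact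
  define k where "k = s div 2"
  \<comment> \<open>As \<open>s\<close> is even and nonzero, \<open>k\<close> is positive; this
    makes every \<open>1 + p^k x\<close> a unit of the local ring.\<close>
  have "s \<noteq> 0" using D s by (metis mult_1 power_0)
  then have k: "k > 0" using c(1) by (auto simp: k_def)
  have c0: "c \<noteq> 0" using c(3) by auto
  have lr: "lrec_roots (int_localized_ring p) (of_int P) (of_int Q) complex_field of_rat \<theta>1 \<theta>2"
    by (rule lrec_roots_localized[OF p roots])
  interpret lrec_roots "int_localized_ring p" "of_int P" "of_int Q" complex_field of_rat \<theta>1 \<theta>2
    by (rule lr)
  note loc = int_localized_of_int[OF p(1)] int_localized_add[OF p(1)] int_localized_mult[OF p(1)]
    int_localized_diff[OF p(1)] int_localized_uminus[OF p(1)] int_localized_inverse[OF p(1)]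
  have "t1 = t2 + int p ^ k * c" using c(2) by (simp add: k_def)
  then have dt: "(of_int t1 :: rat) = of_int t2 + of_nat p ^ k * of_int c" by simp
  have nrm_eq: "nrm a b = (a - b * of_int t1) * (a - b * of_int t2)" if "a \<in> int_localized p" "b \<in> int_localized p" for a b
    using nrm_split[of "of_int t1" "of_int t2" a b] that t(1,2) loc by (simp add: int_localized_a_minus[OF p(1)])
  have ratio_rat: "ratio a b = of_rat ((a - b * of_int t1) * inverse (a - b * of_int t2))"
    if "(a, b) \<in> Units quad" for a b
    using that ratio_eq[OF lr, of a b] by (simp add: Units_quad t(1,2) of_rat_diff of_rat_mult of_rat_inverse)
  have "(\<lambda>(a, b). ratio a b) ` Units quad = {1 + of_nat p ^ k * of_rat x | x. x \<in> int_localized p}"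
  proof (intro equalityI subsetI)
    fix y assume "y \<in> (\<lambda>(a, b). ratio a b) ` Units quad"
    then obtain a b where y: "y = ratio a b" and u: "(a, b) \<in> Units quad" by auto
    then have ab: "a \<in> int_localized p" "b \<in> int_localized p" "nrm a b \<in> Units (int_localized_ring p)"
      by (auto simp: Units_quad)
    define e where "e = a - b * of_int t2"
    have e_loc: "e \<in> int_localized p" using ab loc by (simp add: e_def)
    have e1_loc: "a - b * of_int t1 \<in> int_localized p" using ab loc by simp
    have N: "nrm a b = (a - b * of_int t1) * e" using nrm_eq[OF ab(1,2)] by (simp add: e_def)
    have e: "e \<noteq> 0" "inverse e \<in> int_localized p"
    proof -
      have n: "(a - b * of_int t1) * e \<noteq> 0" "inverse ((a - b * of_int t1) * e) \<in> int_localized p"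
        using ab(3) unfolding N Units_int_localized[OF p(1)] by auto
      then show "e \<noteq> 0" by auto
      \<comment> \<open>A factor of a unit is a unit: the inverse of \<open>e\<close> is the other
        factor of the norm times the inverse of the norm, hence lies in the local ring.\<close>
      have eq: "inverse e = (a - b * of_int t1) * inverse ((a - b * of_int t1) * e)"
        using n(1) by (simp add: field_simps)
      show "inverse e \<in> int_localized p"
        by (subst eq) (rule loc(3)[OF e1_loc n(2)])
    qed
    \<comment> \<open>Read off from \<open>a - b t1 = e - p^k b c\<close> after division by
      \<open>e\<close>.\<close>
    define x where "x = - (b * of_int c * inverse e)"
    have x: "x \<in> int_localized p" using ab e loc by (simp add: x_def)
    have "a - b * of_int t1 = e - b * (of_nat p ^ k * of_int c)"
      by (simp add: e_def dt algebra_simps)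
    then have "(a - b * of_int t1) * inverse e = 1 + of_nat p ^ k * x"
      using e(1) by (simp add: x_def field_simps)
    then have "y = of_rat (1 + of_nat p ^ k * x)"
      using ratio_rat[OF u] by (simp add: y e_def)
    then have "y = 1 + of_nat p ^ k * of_rat x" by (simp add: of_rat_add of_rat_mult of_rat_power)
    then show "y \<in> {1 + of_nat p ^ k * of_rat x | x. x \<in> int_localized p}" using x by blast
  next
    fix y :: complex assume "y \<in> {1 + of_nat p ^ k * of_rat x | x. x \<in> int_localized p}"
    then obtain x where y: "y = 1 + of_nat p ^ k * of_rat x" and x: "x \<in> int_localized p" by blast
    \<comment> \<open>Normalizing \<open>a - b t2\<close> to \<open>1\<close> leaves
      \<open>1 - b p^k c = 1 + p^k x\<close> to be solved for \<open>b\<close>; the norm is then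
      \<open>1 + p^k x\<close> itself.\<close>
    define b where "b = - (x * inverse (of_int c))"
    define a where "a = 1 + b * of_int t2"
    have b_loc: "b \<in> int_localized p"
      using x loc(3,5,6) c(3) by (simp add: b_def)
    have ab: "a \<in> int_localized p" "b \<in> int_localized p"
      using loc(2)[OF loc(1)[of 1] loc(3)[OF b_loc loc(1)[of t2]]] b_loc by (simp_all add: a_def)
    have a2: "a - b * of_int t2 = 1" by (simp add: a_def)
    have a1: "a - b * of_int t1 = 1 + of_nat p ^ k * x"
      using c0 by (simp add: a_def b_def dt field_simps)
    have "nrm a b \<in> Units (int_localized_ring p)"
      using nrm_eq[OF ab] int_localized_add_Units[OF p(1) x k] by (simp add: a1 a2)
    then have u: "(a, b) \<in> Units quad" using ab by (simp add: Units_quad)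
    have "ratio a b = of_rat (1 + of_nat p ^ k * x)"
      using ratio_rat[OF u] by (simp add: a1 a2)
    then have "ratio a b = y" by (simp add: y of_rat_add of_rat_mult of_rat_power)
    then show "y \<in> (\<lambda>(a, b). ratio a b) ` Units quad" using u by force
  qed
  then have M': "M = (units_of complex_field)\<lparr>carrier := (\<lambda>(a, b). ratio a b) ` Units quad\<rparr>"
    by (simp add: M k_def)
  have "\<theta>1 \<noteq> \<theta>2" using t tne by auto
  from Gstar_iso_via_ratio[OF this M'] show "Gstar_iso_via (int_localized_ring p) (of_int P) (of_int Q) M (generate M {\<theta>1 * inverse \<theta>2})
    (\<lambda>w1 w0. (of_rat w1 - of_rat w0 * \<theta>1) * inverse (of_rat w1 - of_rat w0 * \<theta>2))"
    using t Q0 by (subst (asm) Gstar_iso_via_ratio_complex[OF lr]) auto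
qed

theorem theorem6:
  fixes P Q D\<^sub>0 :: int and p s :: nat and \<theta>1 \<theta>2 :: complex
  assumes "Q \<noteq> 0"
    and "P\<^sup>2 - 4 * Q \<noteq> 0"
    and "Factorial_Ring.prime p"
    and "\<not> int p dvd Q"
    and "P\<^sup>2 - 4 * Q = int p ^ s * D\<^sub>0"
    and "\<not> int p dvd D\<^sub>0"
    and "has_roots2 complex_field (of_int P) (of_int Q) \<theta>1 \<theta>2"
  shows
   "\<comment> \<open>(1)\<close>
    (irreducible2 rat_field (of_int P) (of_int Q) \<longrightarrow>
      (let M = units_in complex_field (generate_field complex_field (insert \<theta>1 (of_rat ` carrier rat_field)))
       in Gstar_iso_via rat_field (of_int P) (of_int Q)
            M (times_cyclic M (of_rat ` Units rat_field) \<theta>1)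
            (\<lambda>w1 w0. of_rat w1 - of_rat w0 * \<theta>1))) \<and>
    (\<not> irreducible2 rat_field (of_int P) (of_int Q) \<longrightarrow>
      (let M = units_in complex_field (of_rat ` carrier rat_field)
       in Gstar_iso_via rat_field (of_int P) (of_int Q)
            M (generate M {\<theta>1 * inverse \<theta>2})
            (\<lambda>w1 w0. (of_rat w1 - of_rat w0 * \<theta>1) * inverse (of_rat w1 - of_rat w0 * \<theta>2)))) \<and>
    \<comment> \<open>(2)\<close>
    (irreducible2 rat_field (of_int P) (of_int Q) \<longrightarrow>
      (let M = units_in complex_field (generate_ring complex_field (insert \<theta>1 (of_rat ` int_localized p)))
       in Gstar_iso_via (int_localized_ring p) (of_int P) (of_int Q)
            M (times_cyclic M (of_rat ` Units (int_localized_ring p)) \<theta>1)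
            (\<lambda>w1 w0. of_rat w1 - of_rat w0 * \<theta>1))) \<and>
    (\<not> irreducible2 rat_field (of_int P) (of_int Q) \<and> \<not> int p dvd P\<^sup>2 - 4 * Q \<longrightarrow>
      (let M = units_in complex_field (of_rat ` int_localized p)
       in Gstar_iso_via (int_localized_ring p) (of_int P) (of_int Q)
            M (generate M {\<theta>1 * inverse \<theta>2})
            (\<lambda>w1 w0. (of_rat w1 - of_rat w0 * \<theta>1) * inverse (of_rat w1 - of_rat w0 * \<theta>2)))) \<and>
    (\<not> irreducible2 rat_field (of_int P) (of_int Q) \<and> int p dvd P\<^sup>2 - 4 * Q \<longrightarrow>
      even s \<and>
      (let M = (units_of complex_field)
                 \<lparr>carrier := {1 + of_nat p ^ (s div 2) * of_rat x | x. x \<in> int_localized p}\<rparr>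
       in Gstar_iso_via (int_localized_ring p) (of_int P) (of_int Q)
            M (generate M {\<theta>1 * inverse \<theta>2})
            (\<lambda>w1 w0. (of_rat w1 - of_rat w0 * \<theta>1) * inverse (of_rat w1 - of_rat w0 * \<theta>2)))) \<and>
    \<comment> \<open>(3)(i), and (3)(ii) for \<open>p\<close> not dividing the discriminant\<close>
    (\<forall>(L :: 'l ring) h \<eta>1 \<eta>2.
      field L \<and> h \<in> ring_hom (prime_field p) L \<and>
      has_roots2 L (h (P mod int p)) (h (Q mod int p)) \<eta>1 \<eta>2 \<longrightarrow>
      (irreducible2 (prime_field p) (P mod int p) (Q mod int p) \<longrightarrow>
        (let M = units_in L (generate_field L (insert \<eta>1 (h ` carrier (prime_field p))))
         in Gstar_iso_via (prime_field p) (P mod int p) (Q mod int p)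
              M (times_cyclic M (h ` Units (prime_field p)) \<eta>1)
              (\<lambda>w1 w0. h w1 \<ominus>\<^bsub>L\<^esub> h w0 \<otimes>\<^bsub>L\<^esub> \<eta>1))) \<and>
      (\<not> irreducible2 (prime_field p) (P mod int p) (Q mod int p) \<and> \<not> int p dvd P\<^sup>2 - 4 * Q \<longrightarrow>
        (let M = units_in L (h ` carrier (prime_field p))
         in Gstar_iso_via (prime_field p) (P mod int p) (Q mod int p)
              M (generate M {\<eta>1 \<otimes>\<^bsub>L\<^esub> inv\<^bsub>L\<^esub> \<eta>2})
              (\<lambda>w1 w0. (h w1 \<ominus>\<^bsub>L\<^esub> h w0 \<otimes>\<^bsub>L\<^esub> \<eta>1) \<otimes>\<^bsub>L\<^esub>
                       inv\<^bsub>L\<^esub> (h w1 \<ominus>\<^bsub>L\<^esub> h w0 \<otimes>\<^bsub>L\<^esub> \<eta>2))))) \<and>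
    \<comment> \<open>(3)(ii) for \<open>p\<close> dividing the discriminant\<close>
    (\<not> irreducible2 (prime_field p) (P mod int p) (Q mod int p) \<and> int p dvd P\<^sup>2 - 4 * Q \<longrightarrow>
      trivial_group (Gstar (prime_field p) (P mod int p) (Q mod int p)))"
  \<comment> \<open>Unfolding the \<open>let\<close> puts the explicit group in place of
    \<open>M\<close>; the premise naming \<open>M\<close> in each case lemma is then closed by
    \<open>refl\<close>.\<close>
  using assms unfolding Let_def
  by (intro conjI impI allI; (elim conjE)?)
    (assumption | rule rat_irreducible_iso rat_split_iso localized_irreducible_iso localized_split_iso
      localized_ramified_iso prime_field_irreducible_iso prime_field_split_iso
      trivial_Gstar_prime_field refl)+

end
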